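(* Let $\{B_t\}_{t\in[0,T]}$ be a standard Brownian motion. Let $\{Y_t\}_{t\in[0,T]}$ be a complex-valued process such that for each $t\in[0,T]$, $Y_t$ is square integrable and measurable with respect to $\sigma(B_t)$, and belongs to the domains of $D_t$, $D_t^*$, $D_tD_t^*$ and $D_t^*D_t$. Let $g,\tilde g:[0,T]\to\mathbb R$ be Borel measurable, and assume the measurability and square-integrability conditions needed for the stochastic integrals below to exist. Then $$E\Big[\Big|\int_0^T (B_t-g(t))Y_t\,dB_t\Big|^2\Big]^{1/2}\,E\Big[\Big|\int_0^T (B_t-\tilde g(t))\,\mathcal GY_t\,dB_t\Big|^2\Big]^{1/2}\ \ge\ E\Big[\int_0^T t\,|Y_t|^2\,dt\Big].$$
   Context: Let $\{B_t\}_{t\ge0}$ be a standard Brownian motion on a probability space $(\Omega,\mathcal F,P)$ with its filtration, so $\langle B\rangle_t=t$. For $c\in\mathbb C$ and $t\ge0$ define $\mathcal E_{c,t}:=\exp\!\big(cB_t-\tfrac12 c^2 t\big)$. Let $V_t$ be the complex linear span of $\{\mathcal E_{c,t}:c\in\mathbb C\}$ and $\mathcal H_t$ its closure in $L^2(\Omega,\mathcal F,P)$ (which equals $L^2(\Omega,\sigma(B_t),P)$), with inner product $\langle U,V\rangle=E[U\overline V]$. Let $\mathcal H$ be the closure in $L^2(\Omega,\mathcal F,P)$ of the span of all $\mathcal E_{c,t}$, $c\in\mathbb C$, $t\in[0,T]$, and let $\mathcal G:\mathcal H\to\mathcal H$ be the unique unitary operator with $\mathcal G\mathcal E_{c,t}=\mathcal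 E_{-ic,t}$. The differential operator $D_t$ is defined on $V_t$ by $D_t\mathcal E_{c,t}=c\,t\,\mathcal E_{c,t}$ (extended linearly); $D_t$ also denotes its closure (a closed operator in $\mathcal H_t$), and $D_t^*$ is its adjoint in $\mathcal H_t$. *)

theory Defs
  imports "HOL-Probability.Probability"
begin

definition std_BM :: "'a measure \<Rightarrow> real \<Rightarrow> (real \<Rightarrow> 'a \<Rightarrow> real) \<Rightarrow> bool" where
  "std_BM M T B \<longleftrightarrow>
     prob_space M \<and>
     (\<forall>t\<in>{0..T}. B t \<in> borel_measurable M) \<and>
     (AE \<omega> in M. B 0 \<omega> = 0) \<and>
     (\<forall>s t. 0 \<le> s \<and> s < t \<and> t \<le> T \<longrightarrow>
        distributed M lborel (\<lambda>\<omega>. B t \<omega> - B s \<omega>)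
          (\<lambda>x. ennreal (normal_density 0 (sqrt (t - s)) x))) \<and>
     (\<forall>ts. sorted ts \<and> set ts \<subseteq> {0..T} \<longrightarrow>
        prob_space.indep_vars M (\<lambda>_. borel)
          (\<lambda>i \<omega>. B (ts ! Suc i) \<omega> - B (ts ! i) \<omega>) {..<length ts - 1}) \<and>
     (AE \<omega> in M. continuous_on {0..T} (\<lambda>t. B t \<omega>))"

definition nat_filt :: "'a measure \<Rightarrow> (real \<Rightarrow> 'a \<Rightarrow> real) \<Rightarrow> real \<Rightarrow> 'a measure" where
  "nat_filt M B t = sigma (space M) {B s -` A \<inter> space M | s A. s \<in> {0..t} \<and> A \<in> sets borel}"

definition sq_int :: "'a measure \<Rightarrow> ('a \<Rightarrow> complex) \<Rightarrow> bool" where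
  "sq_int M X \<longleftrightarrow> X \<in> borel_measurable M \<and> integrable M (\<lambda>\<omega>. (cmod (X \<omega>))\<^sup>2)"

definition L2conv :: "'a measure \<Rightarrow> (nat \<Rightarrow> 'a \<Rightarrow> complex) \<Rightarrow> ('a \<Rightarrow> complex) \<Rightarrow> bool" where
  "L2conv M Xs X \<longleftrightarrow> ((\<lambda>n. \<integral>\<^sup>+\<omega>. ennreal ((cmod (Xs n \<omega> - X \<omega>))\<^sup>2) \<partial>M) \<longlonglongrightarrow> 0)"

definition expo :: "(real \<Rightarrow> 'a \<Rightarrow> real) \<Rightarrow> complex \<Rightarrow> real \<Rightarrow> 'a \<Rightarrow> complex" where
  "expo B c t \<omega> = exp (c * complex_of_real (B t \<omega>) - c\<^sup>2 * complex_of_real t / 2)"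

definition vt :: "(real \<Rightarrow> 'a \<Rightarrow> real) \<Rightarrow> real \<Rightarrow> (complex \<times> complex) list \<Rightarrow> 'a \<Rightarrow> complex" where
  "vt B t xs = (\<lambda>\<omega>. sum_list (map (\<lambda>(a, c). a * expo B c t \<omega>) xs))"

text \<open>D_t applied to that element: D_t E_{c,t} = c t E_{c,t}, extended linearly.\<close>
definition dt :: "(real \<Rightarrow> 'a \<Rightarrow> real) \<Rightarrow> real \<Rightarrow> (complex \<times> complex) list \<Rightarrow> 'a \<Rightarrow> complex" where
  "dt B t xs = (\<lambda>\<omega>. sum_list (map (\<lambda>(a, c). a * c * complex_of_real t * expo B c t \<omega>) xs))"

definition v_all :: "(real \<Rightarrow> 'a \<Rightarrow> real) \<Rightarrow> (complex \<times> complex \<times> real) list \<Rightarrow> 'a \<Rightarrow> complex" where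
  "v_all B xs = (\<lambda>\<omega>. sum_list (map (\<lambda>(a, c, s). a * expo B c s \<omega>) xs))"

definition Hspace_t :: "'a measure \<Rightarrow> (real \<Rightarrow> 'a \<Rightarrow> real) \<Rightarrow> real \<Rightarrow> ('a \<Rightarrow> complex) set" where
  "Hspace_t M B t = {X. sq_int M X \<and> (\<exists>xss. L2conv M (\<lambda>n. vt B t (xss n)) X)}"

definition Hspace :: "'a measure \<Rightarrow> (real \<Rightarrow> 'a \<Rightarrow> real) \<Rightarrow> real \<Rightarrow> ('a \<Rightarrow> complex) set" where
  "Hspace M B T = {X. sq_int M X \<and>
     (\<exists>xss. (\<forall>n. \<forall>(a, c, s) \<in> set (xss n). s \<in> {0..T}) \<and> L2conv M (\<lambda>n. v_all B (xss n)) X)}"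

text \<open>Graph of the closure of D_t (as an operator in H_t).\<close>
definition D_graph :: "'a measure \<Rightarrow> (real \<Rightarrow> 'a \<Rightarrow> real) \<Rightarrow> real \<Rightarrow> (('a \<Rightarrow> complex) \<times> ('a \<Rightarrow> complex)) set" where
  "D_graph M B t = {(X, Z). sq_int M X \<and> sq_int M Z \<and>
     (\<exists>xss. L2conv M (\<lambda>n. vt B t (xss n)) X \<and> L2conv M (\<lambda>n. dt B t (xss n)) Z)}"

definition Dadj_graph :: "'a measure \<Rightarrow> (real \<Rightarrow> 'a \<Rightarrow> real) \<Rightarrow> real \<Rightarrow> (('a \<Rightarrow> complex) \<times> ('a \<Rightarrow> complex)) set" where
  "Dadj_graph M B t = {(Y, Z). Y \<in> Hspace_t M B t \<and> Z \<in> Hspace_t M B t \<and>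
     (\<forall>(X, W) \<in> D_graph M B t.
        integral\<^sup>L M (\<lambda>\<omega>. W \<omega> * cnj (Y \<omega>)) = integral\<^sup>L M (\<lambda>\<omega>. X \<omega> * cnj (Z \<omega>)))}"

definition dom_D :: "'a measure \<Rightarrow> (real \<Rightarrow> 'a \<Rightarrow> real) \<Rightarrow> real \<Rightarrow> ('a \<Rightarrow> complex) set" where
  "dom_D M B t = {X. \<exists>Z. (X, Z) \<in> D_graph M B t}"

definition dom_Dstar :: "'a measure \<Rightarrow> (real \<Rightarrow> 'a \<Rightarrow> real) \<Rightarrow> real \<Rightarrow> ('a \<Rightarrow> complex) set" where
  "dom_Dstar M B t = {Y. \<exists>Z. (Y, Z) \<in> Dadj_graph M B t}"

definition dom_DDstar :: "'a measure \<Rightarrow> (real \<Rightarrow> 'a \<Rightarrow> real) \<Rightarrow> real \<Rightarrow> ('a \<Rightarrow> complex) set" where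
  "dom_DDstar M B t = {Y. \<exists>Z. (Y, Z) \<in> Dadj_graph M B t \<and> Z \<in> dom_D M B t}"

definition dom_DstarD :: "'a measure \<Rightarrow> (real \<Rightarrow> 'a \<Rightarrow> real) \<Rightarrow> real \<Rightarrow> ('a \<Rightarrow> complex) set" where
  "dom_DstarD M B t = {Y. \<exists>Z. (Y, Z) \<in> D_graph M B t \<and> Z \<in> dom_Dstar M B t}"

definition valid_partition :: "real \<Rightarrow> real list \<Rightarrow> bool" where
  "valid_partition T ts \<longleftrightarrow> sorted ts \<and> 2 \<le> length ts \<and> hd ts = 0 \<and> last ts = T"

definition simple_adapted ::
  "'a measure \<Rightarrow> (real \<Rightarrow> 'a \<Rightarrow> real) \<Rightarrow> real \<Rightarrow> real list \<Rightarrow> (nat \<Rightarrow> 'a \<Rightarrow> complex) \<Rightarrow> bool" where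
  "simple_adapted M B T ts \<xi> \<longleftrightarrow> valid_partition T ts \<and>
     (\<forall>k < length ts - 1. \<xi> k \<in> borel_measurable (nat_filt M B (ts ! k)) \<and> sq_int M (\<xi> k))"

definition simple_proc :: "real list \<Rightarrow> (nat \<Rightarrow> 'a \<Rightarrow> complex) \<Rightarrow> real \<Rightarrow> 'a \<Rightarrow> complex" where
  "simple_proc ts \<xi> t \<omega> =
     (\<Sum>k < length ts - 1. if ts ! k < t \<and> t \<le> ts ! Suc k then \<xi> k \<omega> else 0)"

definition simple_int :: "(real \<Rightarrow> 'a \<Rightarrow> real) \<Rightarrow> real list \<Rightarrow> (nat \<Rightarrow> 'a \<Rightarrow> complex) \<Rightarrow> 'a \<Rightarrow> complex" where
  "simple_int B ts \<xi> \<omega> =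
     (\<Sum>k < length ts - 1. \<xi> k \<omega> * complex_of_real (B (ts ! Suc k) \<omega> - B (ts ! k) \<omega>))"

definition ito_integral ::
  "'a measure \<Rightarrow> (real \<Rightarrow> 'a \<Rightarrow> real) \<Rightarrow> real \<Rightarrow> (real \<Rightarrow> 'a \<Rightarrow> complex) \<Rightarrow> ('a \<Rightarrow> complex) \<Rightarrow> bool" where
  "ito_integral M B T H I \<longleftrightarrow> sq_int M I \<and>
     (\<exists>tss \<xi>s. (\<forall>n. simple_adapted M B T (tss n) (\<xi>s n)) \<and>
        ((\<lambda>n. \<integral>\<^sup>+\<omega>. (\<integral>\<^sup>+t\<in>{0..T}. ennreal ((cmod (simple_proc (tss n) (\<xi>s n) t \<omega> - H t \<omega>))\<^sup>2) \<partial>lborel) \<partial>M)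
           \<longlonglongrightarrow> 0) \<and>
        L2conv M (\<lambda>n. simple_int B (tss n) (\<xi>s n)) I)"

end

(* For fixed t the map E_c |-> E_{-ic} behaves like a Fourier transform: it carries the operator
   P = -i (D_t - D_t^* ) to multiplication by B_t = D_t + D_t^*.  Since [B_t, P] = 2it, Robertson's
   inequality gives t ||V||^2 <= ||(B_t - g) V|| ||(B_t - g') G V|| for V in V_t; all inner products
   involved are explicit Gaussian integrals.  Moreover ||B_t V|| and ||B_t G V|| are controlled by the
   graph norm of D_t, so the inequality extends to the domain of the closure of D_t.  Ito's isometry
   and the Cauchy-Schwarz inequality in time then give the claim. *)

theory Submission
  imports Defs "HOL-Real_Asymp.Real_Asymp"
begin

text \<open>Three obstacles shape the argument. One element of V_t may be represented by several
  lists of coefficients and exponents. Computations therefore stay on lists: each operator acts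
  entrywise, every inner product is a double sum of one explicit kernel, and the norm identities
  hold pair by pair of entries.

  Multiplication by \<open>B t\<close> is unbounded. The graph norm of D controls it because D and
  its formal adjoint add up to \<open>B t\<close>, while their squared norms on V differ by t times
  the squared norm of V, which is the commutator relation. After rotation a difference replaces the
  sum, and the same bound holds.

  Joint measurability is assumed for the product of B - g and Y, not for Y, and paths are continuous
  only almost surely. Hence Y is recovered by division by a jointly measurable version of B - g,
  which at each positive time is almost surely nonzero because a Gaussian law has no atoms.
  Cauchy-Schwarz in time takes the form of a weighted mean inequality with a parameter l, integrated
  in the extended nonnegative reals and optimised last.\<close>

section \<open>The space of square integrable functions\<close>

text \<open>The choice l = b / a would turn the hypothesis into the claim, but a or b may vanish; so
  both are enlarged by e, which then tends to 0. This recovers a Cauchy-Schwarz bound from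
  inequalities that are linear in squares and hence survive integration.\<close>

lemma le_mult_from_weighted_AMGM:
  fixes x a b :: real
  assumes a: "0 \<le> a" and b: "0 \<le> b"
    and le: "\<And>l. 0 < l \<Longrightarrow> 2 * x \<le> l * a\<^sup>2 + b\<^sup>2 / l"
  shows "x \<le> a * b"
proof -
  have bound: "x \<le> (a + e) * (b + e)" if "0 < e" for e
  proof -
    define l where "l = (b + e) / (a + e)"
    have pos: "0 < a + e" "0 < b + e" using a b that by auto
    have "l * a\<^sup>2 \<le> l * (a + e)\<^sup>2"
      using pos a that unfolding l_def by (intro mult_left_mono power_mono) auto
    also have "\<dots> = (a + e) * (b + e)"
      using pos unfolding l_def by (simp add: power2_eq_square)
    finally have 1: "l * a\<^sup>2 \<le> (a + e) * (b + e)" .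
    have "b\<^sup>2 / l \<le> (b + e)\<^sup>2 / l"
      using pos b that unfolding l_def by (intro divide_right_mono power_mono) auto
    also have "\<dots> = (a + e) * (b + e)"
      using pos unfolding l_def by (simp add: power2_eq_square)
    finally have 2: "b\<^sup>2 / l \<le> (a + e) * (b + e)" .
    have "0 < l" using pos unfolding l_def by simp
    from le[OF this] 1 2 show ?thesis by linarith
  qed
  have "((\<lambda>e. (a + e) * (b + e)) \<longlongrightarrow> (a + 0) * (b + 0)) (at_right 0)"
    by (intro tendsto_intros)
  moreover have "\<forall>\<^sub>F e in at_right 0. x \<le> (a + e) * (b + e)"
    using bound by (auto simp: eventually_at_filter)
  ultimately have "x \<le> (a + 0) * (b + 0)"
    by (intro tendsto_lowerbound) auto
  then show ?thesis by simp
qed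

text \<open>The Bochner integral of a non-integrable function is 0, so the value is guaranteed to be
  the L2 norm only under \<open>sq_int\<close>, which most lemmas on it assume.\<close>

definition l2n :: "'a measure \<Rightarrow> ('a \<Rightarrow> complex) \<Rightarrow> real" where
  "l2n M f = sqrt (integral\<^sup>L M (\<lambda>x. (cmod (f x))\<^sup>2))"

lemma l2n_nonneg [simp]: "0 \<le> l2n M f"
  unfolding l2n_def by simp

lemma l2n_square: "(l2n M f)\<^sup>2 = integral\<^sup>L M (\<lambda>x. (cmod (f x))\<^sup>2)"
  unfolding l2n_def by simp

lemma l2n_square_eq_integral: "complex_of_real ((l2n M f)\<^sup>2) = (\<integral>\<omega>. f \<omega> * cnj (f \<omega>) \<partial>M)"
  unfolding l2n_square complex_norm_square[symmetric]
  by (simp flip: of_real_power)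

lemma sq_int_measurable: "sq_int M f \<Longrightarrow> f \<in> borel_measurable M"
  and sq_int_integrable: "sq_int M f \<Longrightarrow> integrable M (\<lambda>x. (cmod (f x))\<^sup>2)"
  unfolding sq_int_def by auto

lemma sq_int_nn_integral:
  assumes "sq_int M f"
  shows "(\<integral>\<^sup>+x. ennreal ((cmod (f x))\<^sup>2) \<partial>M) = ennreal ((l2n M f)\<^sup>2)"
  unfolding l2n_square using sq_int_integrable[OF assms]
  by (intro nn_integral_eq_integral) auto

lemma sq_int_from_nn_integral:
  assumes "f \<in> borel_measurable M" and "(\<integral>\<^sup>+x. ennreal ((cmod (f x))\<^sup>2) \<partial>M) < \<infinity>"
  shows "sq_int M f"
  unfolding sq_int_def using assms by (auto intro!: integrableI_nonneg)

lemma cmod_add_square_le: "(cmod (x + y))\<^sup>2 \<le> (cmod x)\<^sup>2 + (cmod y)\<^sup>2 + 2 * (cmod x * cmod y)"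
proof -
  have "(cmod (x + y))\<^sup>2 \<le> (cmod x + cmod y)\<^sup>2"
    by (intro power_mono norm_triangle_ineq) auto
  then show ?thesis by (simp add: power2_eq_square algebra_simps)
qed

lemma weighted_AMGM:
  fixes x y l :: real
  assumes "0 < l"
  shows "2 * (x * y) \<le> l * x\<^sup>2 + y\<^sup>2 / l"
proof -
  have "0 \<le> (l * x - y)\<^sup>2 / l" using assms by simp
  also have "\<dots> = l * x\<^sup>2 + y\<^sup>2 / l - 2 * (x * y)"
    using assms by (simp add: power2_eq_square field_simps)
  finally show ?thesis by simp
qed

lemma sq_int_norm_mult_integrable:
  assumes "sq_int M f" "sq_int M g"
  shows "integrable M (\<lambda>x. cmod (f x) * cmod (g x))"
proof (rule Bochner_Integration.integrable_bound)
  show "integrable M (\<lambda>x. (cmod (f x))\<^sup>2 + (cmod (g x))\<^sup>2)"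
    using assms by (auto intro: sq_int_integrable)
  show "(\<lambda>x. cmod (f x) * cmod (g x)) \<in> borel_measurable M"
    using assms[THEN sq_int_measurable] by measurable
  show "AE x in M. norm (cmod (f x) * cmod (g x)) \<le> norm ((cmod (f x))\<^sup>2 + (cmod (g x))\<^sup>2)"
  proof (rule AE_I2)
    fix x
    have "2 * (cmod (f x) * cmod (g x)) \<le> 1 * (cmod (f x))\<^sup>2 + (cmod (g x))\<^sup>2 / 1"
      by (intro weighted_AMGM) simp
    then show "norm (cmod (f x) * cmod (g x)) \<le> norm ((cmod (f x))\<^sup>2 + (cmod (g x))\<^sup>2)"
      by (simp add: abs_mult) (smt (verit) mult_nonneg_nonneg norm_ge_zero)
  qed
qed

lemma sq_int_mult_integrable:
  assumes "sq_int M f" "sq_int M g"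
  shows "integrable M (\<lambda>x. f x * g x)"
  using assms[THEN sq_int_measurable]
  by (intro Bochner_Integration.integrable_bound[OF sq_int_norm_mult_integrable[OF assms]])
     (auto simp: norm_mult)

lemma borel_measurable_cnj [measurable]: "cnj \<in> borel_measurable borel"
  by (intro borel_measurable_continuous_onI continuous_intros)

lemma sq_int_cnj: "sq_int M f \<Longrightarrow> sq_int M (\<lambda>x. cnj (f x))"
  unfolding sq_int_def by (auto intro: measurable_compose[OF _ borel_measurable_cnj])

lemma sq_int_cmult: "sq_int M f \<Longrightarrow> sq_int M (\<lambda>x. a * f x)"
  unfolding sq_int_def by (auto simp: norm_mult power_mult_distrib)

lemma sq_int_add:
  assumes "sq_int M f" "sq_int M g"
  shows "sq_int M (\<lambda>x. f x + g x)"
  unfolding sq_int_def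
proof
  note [measurable] = assms[THEN sq_int_measurable]
  show "(\<lambda>x. f x + g x) \<in> borel_measurable M" by measurable
  show "integrable M (\<lambda>x. (cmod (f x + g x))\<^sup>2)"
  proof (rule Bochner_Integration.integrable_bound)
    show "integrable M (\<lambda>x. (cmod (f x))\<^sup>2 + (cmod (g x))\<^sup>2 + 2 * (cmod (f x) * cmod (g x)))"
      using sq_int_norm_mult_integrable[OF assms] assms[THEN sq_int_integrable] by simp
    show "(\<lambda>x. (cmod (f x + g x))\<^sup>2) \<in> borel_measurable M" by measurable
    show "AE x in M. norm ((cmod (f x + g x))\<^sup>2)
        \<le> norm ((cmod (f x))\<^sup>2 + (cmod (g x))\<^sup>2 + 2 * (cmod (f x) * cmod (g x)))"
      using cmod_add_square_le by (intro AE_I2) (auto intro: order_trans)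
  qed
qed

lemma sq_int_diff:
  assumes "sq_int M f" "sq_int M g"
  shows "sq_int M (\<lambda>x. f x - g x)"
  using sq_int_add[OF assms(1) sq_int_cmult[OF assms(2), of "-1"]] by simp

lemma sq_int_zero: "sq_int M (\<lambda>x. 0)"
  unfolding sq_int_def by simp

lemma sq_int_sum:
  assumes "\<And>i. i \<in> A \<Longrightarrow> sq_int M (f i)"
  shows "sq_int M (\<lambda>x. \<Sum>i\<in>A. f i x)"
  using assms by (induction A rule: infinite_finite_induct) (auto simp: sq_int_zero sq_int_add)

text \<open>The pointwise weighted mean inequality is integrated for each fixed l; optimising over l
  afterwards gives Cauchy-Schwarz without dividing by a norm that may be 0.\<close>

lemma l2n_norm_mult_le:
  assumes "sq_int M f" "sq_int M g"
  shows "integral\<^sup>L M (\<lambda>x. cmod (f x) * cmod (g x)) \<le> l2n M f * l2n M g"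
proof (rule le_mult_from_weighted_AMGM)
  fix l :: real
  assume l: "0 < l"
  have "2 * integral\<^sup>L M (\<lambda>x. cmod (f x) * cmod (g x))
      = integral\<^sup>L M (\<lambda>x. 2 * (cmod (f x) * cmod (g x)))" by simp
  also have "\<dots> \<le> integral\<^sup>L M (\<lambda>x. l * (cmod (f x))\<^sup>2 + (cmod (g x))\<^sup>2 / l)"
    using sq_int_norm_mult_integrable[OF assms] assms[THEN sq_int_integrable] weighted_AMGM[OF l]
    by (intro integral_mono) auto
  also have "\<dots> = l * (l2n M f)\<^sup>2 + (l2n M g)\<^sup>2 / l"
    using assms[THEN sq_int_integrable] unfolding l2n_square by simp
  finally show "2 * integral\<^sup>L M (\<lambda>x. cmod (f x) * cmod (g x))
      \<le> l * (l2n M f)\<^sup>2 + (l2n M g)\<^sup>2 / l" .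
qed auto

lemma l2n_Cauchy_Schwarz:
  assumes "sq_int M f" "sq_int M g"
  shows "cmod (integral\<^sup>L M (\<lambda>x. f x * cnj (g x))) \<le> l2n M f * l2n M g"
proof -
  have "cmod (integral\<^sup>L M (\<lambda>x. f x * cnj (g x))) \<le> integral\<^sup>L M (\<lambda>x. cmod (f x * cnj (g x)))"
    by (rule integral_norm_bound)
  also have "\<dots> = integral\<^sup>L M (\<lambda>x. cmod (f x) * cmod (g x))" by (simp add: norm_mult)
  also have "\<dots> \<le> l2n M f * l2n M g" by (rule l2n_norm_mult_le[OF assms])
  finally show ?thesis .
qed

lemma l2n_triangle:
  assumes "sq_int M f" "sq_int M g"
  shows "l2n M (\<lambda>x. f x + g x) \<le> l2n M f + l2n M g"
proof (rule power2_le_imp_le)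
  have "(l2n M (\<lambda>x. f x + g x))\<^sup>2
      \<le> integral\<^sup>L M (\<lambda>x. (cmod (f x))\<^sup>2 + (cmod (g x))\<^sup>2 + 2 * (cmod (f x) * cmod (g x)))"
    unfolding l2n_square
    using sq_int_norm_mult_integrable[OF assms] assms[THEN sq_int_integrable]
      sq_int_integrable[OF sq_int_add[OF assms]] cmod_add_square_le
    by (intro integral_mono) auto
  also have "\<dots> = (l2n M f)\<^sup>2 + (l2n M g)\<^sup>2 + 2 * integral\<^sup>L M (\<lambda>x. cmod (f x) * cmod (g x))"
    using sq_int_norm_mult_integrable[OF assms] assms[THEN sq_int_integrable]
    unfolding l2n_square by simp
  also have "\<dots> \<le> (l2n M f + l2n M g)\<^sup>2"
    using l2n_norm_mult_le[OF assms] by (simp add: power2_sum)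
  finally show "(l2n M (\<lambda>x. f x + g x))\<^sup>2 \<le> (l2n M f + l2n M g)\<^sup>2" .
qed simp

lemma l2n_cmult: "l2n M (\<lambda>x. a * f x) = cmod a * l2n M f"
  unfolding l2n_def by (simp add: norm_mult power_mult_distrib real_sqrt_mult)

lemma l2n_minus_commute: "l2n M (\<lambda>x. f x - g x) = l2n M (\<lambda>x. g x - f x)"
  unfolding l2n_def by (simp add: norm_minus_commute)

lemma l2n_triangle_diff:
  assumes "sq_int M f" "sq_int M g"
  shows "l2n M (\<lambda>x. f x - g x) \<le> l2n M f + l2n M g"
  using l2n_triangle[OF assms(1) sq_int_cmult[OF assms(2), of "-1"]] l2n_cmult[of M "-1" g] by simp

lemma l2n_diff_abs:
  assumes "sq_int M f" "sq_int M g"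
  shows "\<bar>l2n M f - l2n M g\<bar> \<le> l2n M (\<lambda>x. f x - g x)"
  using l2n_triangle[OF sq_int_diff[OF assms] assms(2)]
    l2n_triangle[OF sq_int_diff[OF assms(2,1)] assms(1)] l2n_minus_commute[of M f g] by simp

lemma l2n_cong_AE:
  assumes "f \<in> borel_measurable M" "g \<in> borel_measurable M" "AE x in M. f x = g x"
  shows "l2n M f = l2n M g"
  unfolding l2n_def using assms by (intro arg_cong[where f=sqrt] integral_cong_AE) auto

lemma l2n_LIMSEQ:
  assumes "\<And>n. sq_int M (Xs n)" "sq_int M X" "(\<lambda>n. l2n M (\<lambda>x. Xs n x - X x)) \<longlonglongrightarrow> 0"
  shows "(\<lambda>n. l2n M (Xs n)) \<longlonglongrightarrow> l2n M X"
proof -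
  have "(\<lambda>n. l2n M (Xs n) - l2n M X) \<longlonglongrightarrow> 0"
    by (rule Lim_null_comparison[OF _ assms(3)])
       (simp add: l2n_diff_abs[OF assms(1,2)])
  then show ?thesis by (rule LIM_zero_cancel)
qed

lemma L2conv_iff_l2n:
  assumes "\<And>n. sq_int M (Xs n)" "sq_int M X"
  shows "L2conv M Xs X \<longleftrightarrow> (\<lambda>n. l2n M (\<lambda>x. Xs n x - X x)) \<longlonglongrightarrow> 0"
proof -
  have "L2conv M Xs X \<longleftrightarrow> (\<lambda>n. ennreal ((l2n M (\<lambda>x. Xs n x - X x))\<^sup>2)) \<longlonglongrightarrow> ennreal 0"
    unfolding L2conv_def using sq_int_diff[OF assms] by (simp add: sq_int_nn_integral)
  also have "\<dots> \<longleftrightarrow> (\<lambda>n. (l2n M (\<lambda>x. Xs n x - X x))\<^sup>2) \<longlonglongrightarrow> 0"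
    by (subst tendsto_ennreal_iff) auto
  also have "\<dots> \<longleftrightarrow> (\<lambda>n. l2n M (\<lambda>x. Xs n x - X x)) \<longlonglongrightarrow> 0"
    by simp
  finally show ?thesis .
qed

text \<open>Multiplication by a measurable, possibly unbounded \<open>\<phi>\<close> is a closed
  operator. The limit is identified through a subsequence along which \<open>Xs\<close> converges
  almost everywhere, and Fatou's lemma turns the Cauchy bound into a bound on the distance to the
  product of \<open>\<phi>\<close> and X.\<close>

lemma l2_closed_multiplication:
  fixes \<phi> :: "'a \<Rightarrow> complex"
  assumes X: "\<And>n. sq_int M (Xs n)" "sq_int M X"
    and conv: "(\<lambda>n. l2n M (\<lambda>x. Xs n x - X x)) \<longlonglongrightarrow> 0"
    and \<phi>[measurable]: "\<phi> \<in> borel_measurable M"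
    and \<phi>X: "\<And>n. sq_int M (\<lambda>x. \<phi> x * Xs n x)"
    and cau: "\<And>e. 0 < e \<Longrightarrow> \<exists>N. \<forall>m\<ge>N. \<forall>n\<ge>N. l2n M (\<lambda>x. \<phi> x * Xs n x - \<phi> x * Xs m x) \<le> e"
  shows "sq_int M (\<lambda>x. \<phi> x * X x)"
    and "(\<lambda>n. l2n M (\<lambda>x. \<phi> x * Xs n x - \<phi> x * X x)) \<longlonglongrightarrow> 0"
proof -
  note [measurable] = X[THEN sq_int_measurable]
  have "\<exists>r::nat\<Rightarrow>nat. strict_mono r \<and> (AE x in M. (\<lambda>n. (cmod (Xs (r n) x - X x))\<^sup>2) \<longlonglongrightarrow> 0)"
  proof (rule tendsto_L1_AE_subseq)
    show "integrable M (\<lambda>x. (cmod (Xs n x - X x))\<^sup>2)" for n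
      using sq_int_integrable[OF sq_int_diff[OF X]] .
    show "(\<lambda>n. \<integral>x. norm ((cmod (Xs n x - X x))\<^sup>2) \<partial>M) \<longlonglongrightarrow> 0"
      using tendsto_power[OF conv, of 2] by (simp add: l2n_square)
  qed
  then obtain r :: "nat \<Rightarrow> nat" where r: "strict_mono r"
    and AE0: "AE x in M. (\<lambda>n. (cmod (Xs (r n) x - X x))\<^sup>2) \<longlonglongrightarrow> 0" by blast
  have AE1: "AE x in M. (\<lambda>n. Xs (r n) x) \<longlonglongrightarrow> X x"
    using AE0
  proof eventually_elim
    case (elim x)
    then have "(\<lambda>n. cmod (Xs (r n) x - X x)) \<longlonglongrightarrow> 0" by simp
    then show ?case by (simp add: LIM_zero_iff tendsto_norm_zero_iff)
  qed
  \<comment> \<open>Fatou along \<open>r\<close>: the second index is \<open>r k\<close>, and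
    \<open>k \<le> r k\<close> puts it beyond N. The bound is stated with a nonnegative integral
    since square integrability of the limit is only deduced from it.\<close>
  have bound: "(\<integral>\<^sup>+x. ennreal ((cmod (\<phi> x * Xs n x - \<phi> x * X x))\<^sup>2) \<partial>M) \<le> ennreal (e\<^sup>2)"
    if N: "\<forall>m\<ge>N. \<forall>n\<ge>N. l2n M (\<lambda>x. \<phi> x * Xs n x - \<phi> x * Xs m x) \<le> e" and n: "N \<le> n" for n N e
  proof -
    have "(\<integral>\<^sup>+x. ennreal ((cmod (\<phi> x * Xs n x - \<phi> x * X x))\<^sup>2) \<partial>M)
        = (\<integral>\<^sup>+x. liminf (\<lambda>k. ennreal ((cmod (\<phi> x * Xs n x - \<phi> x * Xs (r k) x))\<^sup>2)) \<partial>M)"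
    proof (rule nn_integral_cong_AE)
      show "AE x in M. ennreal ((cmod (\<phi> x * Xs n x - \<phi> x * X x))\<^sup>2)
          = liminf (\<lambda>k. ennreal ((cmod (\<phi> x * Xs n x - \<phi> x * Xs (r k) x))\<^sup>2))"
        using AE1
      proof eventually_elim
        case (elim x)
        have "(\<lambda>k. ennreal ((cmod (\<phi> x * Xs n x - \<phi> x * Xs (r k) x))\<^sup>2))
            \<longlonglongrightarrow> ennreal ((cmod (\<phi> x * Xs n x - \<phi> x * X x))\<^sup>2)"
          by (intro tendsto_ennrealI tendsto_intros elim)
        then show ?case by (intro lim_imp_Liminf[symmetric]) auto
      qed
    qed
    also have "\<dots> \<le> liminf (\<lambda>k. \<integral>\<^sup>+x. ennreal ((cmod (\<phi> x * Xs n x - \<phi> x * Xs (r k) x))\<^sup>2) \<partial>M)"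
      by (rule nn_integral_liminf) measurable
    also have "\<dots> \<le> ennreal (e\<^sup>2)"
    proof (rule Liminf_le, simp)
      show "\<forall>\<^sub>F k in sequentially.
          (\<integral>\<^sup>+x. ennreal ((cmod (\<phi> x * Xs n x - \<phi> x * Xs (r k) x))\<^sup>2) \<partial>M) \<le> ennreal (e\<^sup>2)"
        unfolding eventually_sequentially
      proof (intro exI[of _ N] allI impI)
        fix k assume "N \<le> k"
        then have "N \<le> r k" using seq_suble[OF r, of k] by simp
        then have "l2n M (\<lambda>x. \<phi> x * Xs n x - \<phi> x * Xs (r k) x) \<le> e" using N n by blast
        then show "(\<integral>\<^sup>+x. ennreal ((cmod (\<phi> x * Xs n x - \<phi> x * Xs (r k) x))\<^sup>2) \<partial>M) \<le> ennreal (e\<^sup>2)"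
          by (subst sq_int_nn_integral[OF sq_int_diff[OF \<phi>X \<phi>X]]) (auto intro!: ennreal_leI power_mono)
      qed
    qed
    finally show ?thesis .
  qed
  have diff: "sq_int M (\<lambda>x. \<phi> x * Xs n x - \<phi> x * X x)"
    if "\<forall>m\<ge>N. \<forall>n\<ge>N. l2n M (\<lambda>x. \<phi> x * Xs n x - \<phi> x * Xs m x) \<le> e" and "N \<le> n" for n N e
    using bound[OF that] by (intro sq_int_from_nn_integral) (auto simp: less_top[symmetric] top_unique)
  obtain N0 where N0: "\<forall>m\<ge>N0. \<forall>n\<ge>N0. l2n M (\<lambda>x. \<phi> x * Xs n x - \<phi> x * Xs m x) \<le> 1"
    using cau[of 1] by auto
  \<comment> \<open>One index at finite distance is enough: the limit is then a difference of two
    square integrable functions.\<close>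
  from sq_int_diff[OF \<phi>X[of N0] diff[OF N0 order_refl]]
  show sq: "sq_int M (\<lambda>x. \<phi> x * X x)" by simp
  show "(\<lambda>n. l2n M (\<lambda>x. \<phi> x * Xs n x - \<phi> x * X x)) \<longlonglongrightarrow> 0"
  proof (rule LIMSEQ_I)
    fix e :: real assume "0 < e"
    then obtain N where N: "\<forall>m\<ge>N. \<forall>n\<ge>N. l2n M (\<lambda>x. \<phi> x * Xs n x - \<phi> x * Xs m x) \<le> e / 2"
      using cau[of "e / 2"] by auto
    have "l2n M (\<lambda>x. \<phi> x * Xs n x - \<phi> x * X x) < e" if "N \<le> n" for n
    proof -
      have "ennreal ((l2n M (\<lambda>x. \<phi> x * Xs n x - \<phi> x * X x))\<^sup>2) \<le> ennreal ((e / 2)\<^sup>2)"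
        using bound[OF N that] by (simp add: sq_int_nn_integral[OF sq_int_diff[OF \<phi>X sq]])
      then have "(l2n M (\<lambda>x. \<phi> x * Xs n x - \<phi> x * X x))\<^sup>2 \<le> (e / 2)\<^sup>2"
        by (subst (asm) ennreal_le_iff) auto
      then have "l2n M (\<lambda>x. \<phi> x * Xs n x - \<phi> x * X x) \<le> e / 2"
        by (rule power2_le_imp_le) (use \<open>0 < e\<close> in simp)
      then show ?thesis using \<open>0 < e\<close> by simp
    qed
    then show "\<exists>no. \<forall>n\<ge>no. norm (l2n M (\<lambda>x. \<phi> x * Xs n x - \<phi> x * X x) - 0) < e"
      by auto
  qed
qed

section \<open>Exponential moments of Gaussian variables\<close>

text \<open>Completing the square: tilting a centred Gaussian by an exponential moves its mean to
  \<open>a * \<sigma>\<^sup>2\<close>, up to a constant factor.\<close>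

lemma exp_mult_normal_density:
  fixes a \<sigma> x :: real
  assumes "0 < \<sigma>"
  shows "exp (a * x) * normal_density 0 \<sigma> x = exp (a\<^sup>2 * \<sigma>\<^sup>2 / 2) * normal_density (a * \<sigma>\<^sup>2) \<sigma> x"
proof -
  have "a * x + - (x - 0)\<^sup>2 / (2 * \<sigma>\<^sup>2) = a\<^sup>2 * \<sigma>\<^sup>2 / 2 + - (x - a * \<sigma>\<^sup>2)\<^sup>2 / (2 * \<sigma>\<^sup>2)"
    using assms by (simp add: field_simps power2_eq_square)
  then have "exp (a * x) * exp (- (x - 0)\<^sup>2 / (2 * \<sigma>\<^sup>2))
      = exp (a\<^sup>2 * \<sigma>\<^sup>2 / 2) * exp (- (x - a * \<sigma>\<^sup>2)\<^sup>2 / (2 * \<sigma>\<^sup>2))"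
    by (simp only: exp_add[symmetric])
  then show ?thesis
    unfolding normal_density_def by (simp add: field_simps)
qed

text \<open>Only the real part of z enters the modulus, so tilting reduces the claim to moments of a
  normal density centred at \<open>m\<close>. Powers up to 2 suffice because each side of an inner
  product carries at most one factor \<open>b\<close>.\<close>

lemma integrable_gaussian_exp_moment:
  fixes z :: complex
  assumes \<sigma>: "0 < \<sigma>" and k: "k \<le> 2"
  shows "integrable lborel (\<lambda>x. complex_of_real (x ^ k) * exp (z * complex_of_real x) * complex_of_real (normal_density 0 \<sigma> x))"
proof (rule Bochner_Integration.integrable_bound)
  define m where "m = Re z * \<sigma>\<^sup>2"
  have 0: "integrable lborel (\<lambda>x. normal_density m \<sigma> x)" using \<sigma> by simp
  have 2: "integrable lborel (\<lambda>x. normal_density m \<sigma> x * (x - m)\<^sup>2)"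
    using integrable_normal_moment[OF \<sigma>] .
  show "integrable lborel (\<lambda>x. exp ((Re z)\<^sup>2 * \<sigma>\<^sup>2 / 2) *
      ((1 + 2 * m\<^sup>2) * normal_density m \<sigma> x + 2 * (normal_density m \<sigma> x * (x - m)\<^sup>2)))"
    using 0 2 by simp
  show "(\<lambda>x. complex_of_real (x ^ k) * exp (z * complex_of_real x) * complex_of_real (normal_density 0 \<sigma> x))
      \<in> borel_measurable lborel"
    by measurable
  show "AE x in lborel. norm (complex_of_real (x ^ k) * exp (z * complex_of_real x) * complex_of_real (normal_density 0 \<sigma> x))
      \<le> norm (exp ((Re z)\<^sup>2 * \<sigma>\<^sup>2 / 2) *
      ((1 + 2 * m\<^sup>2) * normal_density m \<sigma> x + 2 * (normal_density m \<sigma> x * (x - m)\<^sup>2)))"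
  proof (rule AE_I2)
    fix x :: real
    \<comment> \<open>This amounts to ((x - m) + m)^2 \<le> 2 (x - m)^2 + 2 m^2: the second moment
      at hand is the one centred at \<open>m\<close>.\<close>
    have "0 \<le> (x - 2 * m)\<^sup>2" by simp
    then have sq: "x\<^sup>2 \<le> 2 * m\<^sup>2 + 2 * (x - m)\<^sup>2"
      by (simp add: power2_eq_square algebra_simps)
    have "\<bar>x\<bar> * 1 \<le> 1 + x\<^sup>2"
      using weighted_AMGM[of 1 "\<bar>x\<bar>" 1] by simp
    moreover have "k = 0 \<or> k = 1 \<or> k = 2" using k by auto
    ultimately have "\<bar>x\<bar> ^ k \<le> 1 + x\<^sup>2" by auto
    with sq have pow: "\<bar>x\<bar> ^ k \<le> (1 + 2 * m\<^sup>2) + 2 * (x - m)\<^sup>2" by simp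
    have "norm (complex_of_real (x ^ k) * exp (z * complex_of_real x) * complex_of_real (normal_density 0 \<sigma> x))
        = \<bar>x\<bar> ^ k * (exp (Re z * x) * normal_density 0 \<sigma> x)"
      by (simp add: norm_mult norm_power)
    also have "\<dots> = \<bar>x\<bar> ^ k * (exp ((Re z)\<^sup>2 * \<sigma>\<^sup>2 / 2) * normal_density m \<sigma> x)"
      unfolding m_def exp_mult_normal_density[OF \<sigma>] ..
    also have "\<dots> \<le> ((1 + 2 * m\<^sup>2) + 2 * (x - m)\<^sup>2) * (exp ((Re z)\<^sup>2 * \<sigma>\<^sup>2 / 2) * normal_density m \<sigma> x)"
      using pow by (intro mult_right_mono) auto
    also have "\<dots> = exp ((Re z)\<^sup>2 * \<sigma>\<^sup>2 / 2) *
      ((1 + 2 * m\<^sup>2) * normal_density m \<sigma> x + 2 * (normal_density m \<sigma> x * (x - m)\<^sup>2))"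
      by (simp add: algebra_simps)
    also have "\<dots> \<le> norm \<dots>" by simp
    finally show "norm (complex_of_real (x ^ k) * exp (z * complex_of_real x) * complex_of_real (normal_density 0 \<sigma> x))
      \<le> norm (exp ((Re z)\<^sup>2 * \<sigma>\<^sup>2 / 2) *
      ((1 + 2 * m\<^sup>2) * normal_density m \<sigma> x + 2 * (normal_density m \<sigma> x * (x - m)\<^sup>2)))" .
  qed
qed

text \<open>The real part of z is absorbed into a shifted density and the imaginary part into the
  characteristic function of the standard normal law, which replaces an analytic continuation in
  z.\<close>

lemma integral_gaussian_exp:
  fixes z :: complex
  assumes \<sigma>: "0 < \<sigma>"
  shows "(\<integral>x. exp (z * complex_of_real x) * complex_of_real (normal_density 0 \<sigma> x) \<partial>lborel)
    = exp (z\<^sup>2 * complex_of_real (\<sigma>\<^sup>2) / 2)"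
proof -
  define a b m where "a = Re z" and "b = Im z" and "m = a * \<sigma>\<^sup>2"
  have z: "z = complex_of_real a + \<i> * complex_of_real b"
    unfolding a_def b_def by (simp add: complex_eq_iff)
  have split: "exp (z * complex_of_real x) * complex_of_real (normal_density 0 \<sigma> x)
      = complex_of_real (exp (a\<^sup>2 * \<sigma>\<^sup>2 / 2)) * (exp (\<i> * complex_of_real (b * x)) * complex_of_real (normal_density m \<sigma> x))" for x
  proof -
    have "exp (z * complex_of_real x) = complex_of_real (exp (a * x)) * exp (\<i> * complex_of_real (b * x))"
      unfolding z by (simp add: exp_add[symmetric] exp_of_real[symmetric] algebra_simps)
    then have "exp (z * complex_of_real x) * complex_of_real (normal_density 0 \<sigma> x)
      = exp (\<i> * complex_of_real (b * x)) * complex_of_real (exp (a * x) * normal_density 0 \<sigma> x)"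
      by simp
    then show ?thesis unfolding exp_mult_normal_density[OF \<sigma>] m_def by simp
  qed
  \<comment> \<open>The substitution x = m + \<sigma> y standardises the density; the shift m
    survives only as a phase factor.\<close>
  have "(\<integral>x. exp (\<i> * complex_of_real (b * x)) * complex_of_real (normal_density m \<sigma> x) \<partial>lborel)
    = \<bar>\<sigma>\<bar> *\<^sub>R (\<integral>y. exp (\<i> * complex_of_real (b * (m + \<sigma> * y))) * complex_of_real (normal_density m \<sigma> (m + \<sigma> * y)) \<partial>lborel)"
    using \<sigma> by (intro lborel_integral_real_affine) simp
  also have "\<dots> = (\<integral>y. \<bar>\<sigma>\<bar> *\<^sub>R (exp (\<i> * complex_of_real (b * (m + \<sigma> * y))) * complex_of_real (normal_density m \<sigma> (m + \<sigma> * y))) \<partial>lborel)"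
    by simp
  also have "\<dots> = (\<integral>y. exp (\<i> * complex_of_real (b * m)) * (std_normal_density y *\<^sub>R exp (\<i> * complex_of_real ((b * \<sigma>) * y))) \<partial>lborel)"
  proof (rule Bochner_Integration.integral_cong[OF refl])
    fix y :: real
    have nd: "\<sigma> * normal_density m \<sigma> (m + \<sigma> * y) = std_normal_density y"
      using \<sigma> unfolding normal_density_def by (simp add: power_mult_distrib real_sqrt_mult field_simps)
    have e: "exp (\<i> * complex_of_real (b * (m + \<sigma> * y))) = exp (\<i> * complex_of_real (b * m)) * exp (\<i> * complex_of_real ((b * \<sigma>) * y))"
      by (simp add: exp_add[symmetric] algebra_simps)
    show "\<bar>\<sigma>\<bar> *\<^sub>R (exp (\<i> * complex_of_real (b * (m + \<sigma> * y))) * complex_of_real (normal_density m \<sigma> (m + \<sigma> * y)))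
      = exp (\<i> * complex_of_real (b * m)) * (std_normal_density y *\<^sub>R exp (\<i> * complex_of_real ((b * \<sigma>) * y)))"
      unfolding e nd[symmetric] using \<sigma> by (simp add: scaleR_conv_of_real)
  qed
  also have "\<dots> = exp (\<i> * complex_of_real (b * m)) * (\<integral>y. std_normal_density y *\<^sub>R exp (\<i> * complex_of_real ((b * \<sigma>) * y)) \<partial>lborel)"
    by (rule integral_mult_right_zero)
  also have "(\<integral>y. std_normal_density y *\<^sub>R exp (\<i> * complex_of_real ((b * \<sigma>) * y)) \<partial>lborel) = char std_normal_distribution (b * \<sigma>)"
    unfolding char_def by (subst integral_density) auto
  also have "\<dots> = complex_of_real (exp (- ((b * \<sigma>)\<^sup>2) / 2))"
    by (simp add: char_std_normal_distribution)
  finally have I: "(\<integral>x. exp (\<i> * complex_of_real (b * x)) * complex_of_real (normal_density m \<sigma> x) \<partial>lborel)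
    = exp (\<i> * complex_of_real (b * m)) * complex_of_real (exp (- ((b * \<sigma>)\<^sup>2) / 2))" .
  have "complex_of_real (exp (a\<^sup>2 * \<sigma>\<^sup>2 / 2)) * (exp (\<i> * complex_of_real (b * m)) * complex_of_real (exp (- ((b * \<sigma>)\<^sup>2) / 2)))
     = exp (complex_of_real (a\<^sup>2 * \<sigma>\<^sup>2 / 2) + (\<i> * complex_of_real (b * m) + complex_of_real (- ((b * \<sigma>)\<^sup>2) / 2)))"
    by (simp only: exp_add exp_of_real)
  also have "complex_of_real (a\<^sup>2 * \<sigma>\<^sup>2 / 2) + (\<i> * complex_of_real (b * m) + complex_of_real (- ((b * \<sigma>)\<^sup>2) / 2))
     = z\<^sup>2 * complex_of_real (\<sigma>\<^sup>2) / 2"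
    unfolding z m_def by (simp add: complex_eq_iff power2_eq_square algebra_simps)
  finally show ?thesis
    unfolding split by (simp add: I del: of_real_mult)
qed

text \<open>Supplies the integrations by parts behind the first and second moment formulas, with
  vanishing boundary terms.\<close>

lemma integral_derivative_real_line:
  fixes F f :: "real \<Rightarrow> complex"
  assumes deriv: "\<And>x. (F has_vector_derivative f x) (at x)"
    and cont: "\<And>x. isCont f x" and int: "integrable lborel f"
    and lim: "(F \<longlongrightarrow> 0) at_top" "(F \<longlongrightarrow> 0) at_bot"
  shows "(\<integral>x. f x \<partial>lborel) = 0"
proof -
  have "(LBINT x=-\<infinity>..\<infinity>. f x) = 0 - 0"
  proof (rule interval_integral_FTC_integrable[where F=F])
    show "set_integrable lborel (einterval (-\<infinity>) \<infinity>) f"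
      using int by (simp add: einterval_def set_integrable_def)
  qed (use deriv cont lim in \<open>auto simp: ereal_tendsto_simps\<close>)
  then show ?thesis
    by (simp add: interval_lebesgue_integral_def einterval_def set_lebesgue_integral_def)
qed

text \<open>These are the boundary terms of the two integrations by parts, which involve w and x w;
  hence k is at most 1. The quadratic part of the exponent beats the linear one.\<close>

lemma gaussian_exp_tendsto_0:
  fixes z :: complex and k :: nat
  assumes \<sigma>: "0 < \<sigma>" and k: "k \<le> 1"
  defines "F \<equiv> \<lambda>x. complex_of_real (x ^ k) * exp (z * complex_of_real x) * complex_of_real (normal_density 0 \<sigma> x)"
  shows "(F \<longlongrightarrow> 0) at_top" and "(F \<longlongrightarrow> 0) at_bot"
proof -
  define c where "c = 1 / (2 * \<sigma>\<^sup>2)"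
  have c: "0 < c" using \<sigma> unfolding c_def by simp
  have F: "norm (F x) = \<bar>x\<bar> ^ k * exp (Re z * x - c * x\<^sup>2) / sqrt (2 * pi * \<sigma>\<^sup>2)" for x
    unfolding F_def normal_density_def c_def
    by (simp add: norm_mult norm_power norm_divide exp_diff exp_minus field_simps)
  have k': "k = 0 \<or> k = 1" using k by auto
  have "((\<lambda>x. \<bar>x\<bar> ^ k * exp (Re z * x - c * x\<^sup>2) / sqrt (2 * pi * \<sigma>\<^sup>2)) \<longlongrightarrow> 0) at_top"
    using k'
  proof
    assume k: "k = 0"
    show ?thesis unfolding k using \<sigma> c by real_asymp
  next
    assume k: "k = 1"
    show ?thesis unfolding k using \<sigma> c by real_asymp
  qed
  then show "(F \<longlongrightarrow> 0) at_top"
    unfolding F[symmetric] by (rule tendsto_norm_zero_cancel)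
  have "((\<lambda>x. \<bar>x\<bar> ^ k * exp (Re z * x - c * x\<^sup>2) / sqrt (2 * pi * \<sigma>\<^sup>2)) \<longlongrightarrow> 0) at_bot"
    using k'
  proof
    assume k: "k = 0"
    show ?thesis unfolding k using \<sigma> c by real_asymp
  next
    assume k: "k = 1"
    show ?thesis unfolding k using \<sigma> c by real_asymp
  qed
  then show "(F \<longlongrightarrow> 0) at_bot"
    unfolding F[symmetric] by (rule tendsto_norm_zero_cancel)
qed

lemma has_vector_derivative_exp_gaussian:
  fixes z :: complex
  assumes \<sigma>: "0 < \<sigma>"
  shows "((\<lambda>x. exp (z * complex_of_real x) * complex_of_real (normal_density 0 \<sigma> x)) has_vector_derivative
      (z - complex_of_real (x / \<sigma>\<^sup>2)) * (exp (z * complex_of_real x) * complex_of_real (normal_density 0 \<sigma> x))) (at x)"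
proof -
  have eq: "exp (z * complex_of_real x) * complex_of_real (normal_density 0 \<sigma> x)
     = complex_of_real (1 / sqrt (2 * pi * \<sigma>\<^sup>2)) * exp (z * complex_of_real x - (complex_of_real x)\<^sup>2 / complex_of_real (2 * \<sigma>\<^sup>2))" for x
    unfolding normal_density_def
    by (simp add: exp_diff exp_minus exp_of_real[symmetric] field_simps)
  \<comment> \<open>Differentiation takes place in a complex variable, where the field rules apply,
    and is restricted to the real line afterwards.\<close>
  have "((\<lambda>w. complex_of_real (1 / sqrt (2 * pi * \<sigma>\<^sup>2)) * exp (z * w - w\<^sup>2 / complex_of_real (2 * \<sigma>\<^sup>2))) has_field_derivative
      (complex_of_real (1 / sqrt (2 * pi * \<sigma>\<^sup>2)) * (exp (z * w - w\<^sup>2 / complex_of_real (2 * \<sigma>\<^sup>2)) * (z - 2 * w / complex_of_real (2 * \<sigma>\<^sup>2))))) (at w)" for w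
    using \<sigma> by (auto intro!: derivative_eq_intros simp: field_simps power2_eq_square power4_eq_xxxx)
  from has_vector_derivative_real_field[OF this[of "complex_of_real x"]]
  show ?thesis unfolding eq by (simp add: ac_simps)
qed

text \<open>The derivative of \<open>w\<close> is w times z - x / \<sigma>^2 and integrates to 0,
  which expresses the first moment through the zeroth.\<close>

lemma integral_gaussian_exp_moment1:
  fixes z :: complex
  assumes \<sigma>: "0 < \<sigma>"
  shows "(\<integral>x. complex_of_real x * exp (z * complex_of_real x) * complex_of_real (normal_density 0 \<sigma> x) \<partial>lborel)
    = z * complex_of_real (\<sigma>\<^sup>2) * exp (z\<^sup>2 * complex_of_real (\<sigma>\<^sup>2) / 2)"
proof -
  define w where "w x = exp (z * complex_of_real x) * complex_of_real (normal_density 0 \<sigma> x)" for x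
  have i0: "integrable lborel w" and i1: "integrable lborel (\<lambda>x. complex_of_real x * w x)"
    using integrable_gaussian_exp_moment[OF \<sigma>, of 0 z] integrable_gaussian_exp_moment[OF \<sigma>, of 1 z]
    unfolding w_def by (simp_all add: ac_simps)
  have deq: "(z - complex_of_real (x / \<sigma>\<^sup>2)) * w x = z * w x - (1 / complex_of_real (\<sigma>\<^sup>2)) * (complex_of_real x * w x)" for x
    by (simp add: field_simps)
  have cw: "isCont w x" for x
    using has_vector_derivative_continuous[OF has_vector_derivative_exp_gaussian[OF \<sigma>]] unfolding w_def by blast
  have "(\<integral>x. (z - complex_of_real (x / \<sigma>\<^sup>2)) * w x \<partial>lborel) = 0"
  proof (rule integral_derivative_real_line)
    show "(w has_vector_derivative (z - complex_of_real (x / \<sigma>\<^sup>2)) * w x) (at x)" for x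
      using has_vector_derivative_exp_gaussian[OF \<sigma>] unfolding w_def .
    show "isCont (\<lambda>x. (z - complex_of_real (x / \<sigma>\<^sup>2)) * w x) x" for x
      using \<sigma> by (intro continuous_intros cw) simp
    show "integrable lborel (\<lambda>x. (z - complex_of_real (x / \<sigma>\<^sup>2)) * w x)"
      unfolding deq using i0 i1 by simp
    show "(w \<longlongrightarrow> 0) at_top" "(w \<longlongrightarrow> 0) at_bot"
      using gaussian_exp_tendsto_0[OF \<sigma>, of 0 z] unfolding w_def by simp_all
  qed
  then have "z * (\<integral>x. w x \<partial>lborel) - (1 / complex_of_real (\<sigma>\<^sup>2)) * (\<integral>x. complex_of_real x * w x \<partial>lborel) = 0"
    unfolding deq using i0 i1 by simp
  then have "(\<integral>x. complex_of_real x * w x \<partial>lborel) = z * complex_of_real (\<sigma>\<^sup>2) * (\<integral>x. w x \<partial>lborel)"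
    using \<sigma> by (simp add: field_simps)
  then show ?thesis
    using integral_gaussian_exp[OF \<sigma>, of z] unfolding w_def by (simp add: ac_simps)
qed

text \<open>One more integration by parts, now of x w: the second moment reduces to the zeroth and
  the first.\<close>

lemma integral_gaussian_exp_moment2:
  fixes z :: complex
  assumes \<sigma>: "0 < \<sigma>"
  shows "(\<integral>x. complex_of_real (x\<^sup>2) * exp (z * complex_of_real x) * complex_of_real (normal_density 0 \<sigma> x) \<partial>lborel)
    = (complex_of_real (\<sigma>\<^sup>2) + (z * complex_of_real (\<sigma>\<^sup>2))\<^sup>2) * exp (z\<^sup>2 * complex_of_real (\<sigma>\<^sup>2) / 2)"
proof -
  define w where "w x = exp (z * complex_of_real x) * complex_of_real (normal_density 0 \<sigma> x)" for x
  have i0: "integrable lborel w" and i1: "integrable lborel (\<lambda>x. complex_of_real x * w x)"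
    and i2: "integrable lborel (\<lambda>x. complex_of_real (x\<^sup>2) * w x)"
    using integrable_gaussian_exp_moment[OF \<sigma>, of 0 z] integrable_gaussian_exp_moment[OF \<sigma>, of 1 z]
      integrable_gaussian_exp_moment[OF \<sigma>, of 2 z]
    unfolding w_def by (simp_all add: ac_simps)
  have deq: "complex_of_real x * ((z - complex_of_real (x / \<sigma>\<^sup>2)) * w x) + 1 * w x
    = w x + z * (complex_of_real x * w x) - (1 / complex_of_real (\<sigma>\<^sup>2)) * (complex_of_real (x\<^sup>2) * w x)" for x
    by (simp add: field_simps power2_eq_square)
  have dw: "(w has_vector_derivative (z - complex_of_real (x / \<sigma>\<^sup>2)) * w x) (at x)" for x
    using has_vector_derivative_exp_gaussian[OF \<sigma>] unfolding w_def .
  have cw: "isCont w x" for x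
    using has_vector_derivative_continuous[OF dw] .
  have "(\<integral>x. complex_of_real x * ((z - complex_of_real (x / \<sigma>\<^sup>2)) * w x) + 1 * w x \<partial>lborel) = 0"
  proof (rule integral_derivative_real_line)
    show "((\<lambda>x. complex_of_real x * w x) has_vector_derivative
        complex_of_real x * ((z - complex_of_real (x / \<sigma>\<^sup>2)) * w x) + 1 * w x) (at x)" for x
      by (intro has_vector_derivative_mult dw has_vector_derivative_of_real[OF DERIV_ident, simplified])
    show "isCont (\<lambda>x. complex_of_real x * ((z - complex_of_real (x / \<sigma>\<^sup>2)) * w x) + 1 * w x) x" for x
      using \<sigma> by (intro continuous_intros cw) simp
    show "integrable lborel (\<lambda>x. complex_of_real x * ((z - complex_of_real (x / \<sigma>\<^sup>2)) * w x) + 1 * w x)"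
      unfolding deq using i0 i1 i2 by simp
    show "((\<lambda>x. complex_of_real x * w x) \<longlongrightarrow> 0) at_top" "((\<lambda>x. complex_of_real x * w x) \<longlongrightarrow> 0) at_bot"
      using gaussian_exp_tendsto_0[OF \<sigma>, of 1 z] unfolding w_def by (simp_all add: ac_simps)
  qed
  then have "(\<integral>x. w x \<partial>lborel) + z * (\<integral>x. complex_of_real x * w x \<partial>lborel)
      - (1 / complex_of_real (\<sigma>\<^sup>2)) * (\<integral>x. complex_of_real (x\<^sup>2) * w x \<partial>lborel) = 0"
    unfolding deq using i0 i1 i2 by simp
  then have "(\<integral>x. complex_of_real (x\<^sup>2) * w x \<partial>lborel)
      = complex_of_real (\<sigma>\<^sup>2) * ((\<integral>x. w x \<partial>lborel) + z * (\<integral>x. complex_of_real x * w x \<partial>lborel))"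
    using \<sigma> by (simp add: field_simps)
  then show ?thesis
    using integral_gaussian_exp[OF \<sigma>, of z] integral_gaussian_exp_moment1[OF \<sigma>, of z]
    unfolding w_def by (simp add: algebra_simps power2_eq_square)
qed

section \<open>Inner products of exponential sums in one Gaussian variable\<close>

locale gaussian_rv = prob_space M for M :: "'a measure" +
  fixes b :: "'a \<Rightarrow> real" and t :: real
  assumes t_pos: "0 < t"
    and distributed_b: "distributed M lborel b (\<lambda>x. ennreal (normal_density 0 (sqrt t) x))"
begin

lemma measurable_b [measurable]: "b \<in> borel_measurable M"
  using distributed_measurable[OF distributed_b] by simp

lemma
  fixes f :: "real \<Rightarrow> complex"
  assumes [measurable]: "f \<in> borel_measurable borel"
    and int: "integrable lborel (\<lambda>x. f x * complex_of_real (normal_density 0 (sqrt t) x))"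
  shows integrable_b: "integrable M (\<lambda>\<omega>. f (b \<omega>))"
    and integral_b: "(\<integral>\<omega>. f (b \<omega>) \<partial>M) = (\<integral>x. f x * complex_of_real (normal_density 0 (sqrt t) x) \<partial>lborel)"
proof -
  have D: "distr M lborel b = density lborel (\<lambda>x. ennreal (normal_density 0 (sqrt t) x))"
    by (rule distributed_distr_eq_density[OF distributed_b])
  have eq: "f x * complex_of_real (normal_density 0 (sqrt t) x) = normal_density 0 (sqrt t) x *\<^sub>R f x" for x
    by (simp add: scaleR_conv_of_real)
  have "integrable (distr M lborel b) f"
    unfolding D using int by (subst integrable_density) (auto simp: eq)
  then show "integrable M (\<lambda>\<omega>. f (b \<omega>))"
    by (subst (asm) integrable_distr_eq) auto
  have "(\<integral>\<omega>. f (b \<omega>) \<partial>M) = integral\<^sup>L (distr M lborel b) f"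
    by (subst integral_distr) auto
  also have "\<dots> = (\<integral>x. f x * complex_of_real (normal_density 0 (sqrt t) x) \<partial>lborel)"
    unfolding D eq by (subst integral_density) auto
  finally show "(\<integral>\<omega>. f (b \<omega>) \<partial>M) = (\<integral>x. f x * complex_of_real (normal_density 0 (sqrt t) x) \<partial>lborel)" .
qed

lemma integrable_exp_moment:
  assumes "k \<le> 2"
  shows "integrable M (\<lambda>\<omega>. complex_of_real (b \<omega> ^ k) * exp (z * complex_of_real (b \<omega>)))"
  using integrable_gaussian_exp_moment[of "sqrt t" k z] t_pos assms
  by (intro integrable_b[where f="\<lambda>x. complex_of_real (x ^ k) * exp (z * complex_of_real x)"]) auto

lemma integral_exp_moment0:
  fixes z :: complex
  shows
  "(\<integral>\<omega>. exp (z * complex_of_real (b \<omega>)) \<partial>M) = exp (z\<^sup>2 * complex_of_real t / 2)"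
  using integral_gaussian_exp[of "sqrt t" z] integrable_gaussian_exp_moment[of "sqrt t" 0 z] t_pos
  by (subst integral_b[where f="\<lambda>x. exp (z * complex_of_real x)"]) (auto simp: of_real_power[symmetric] simp del: of_real_power)

lemma integral_exp_moment1:
  fixes z :: complex
  shows
  "(\<integral>\<omega>. complex_of_real (b \<omega>) * exp (z * complex_of_real (b \<omega>)) \<partial>M) = z * complex_of_real t * exp (z\<^sup>2 * complex_of_real t / 2)"
  using integral_gaussian_exp_moment1[of "sqrt t" z] integrable_gaussian_exp_moment[of "sqrt t" 1 z] t_pos
  by (subst integral_b[where f="\<lambda>x. complex_of_real x * exp (z * complex_of_real x)"]) (auto simp: of_real_power[symmetric] simp del: of_real_power)

lemma integral_exp_moment2:
  fixes z :: complex
  shows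
  "(\<integral>\<omega>. complex_of_real ((b \<omega>)\<^sup>2) * exp (z * complex_of_real (b \<omega>)) \<partial>M) = (complex_of_real t + (z * complex_of_real t)\<^sup>2) * exp (z\<^sup>2 * complex_of_real t / 2)"
  using integral_gaussian_exp_moment2[of "sqrt t" z] integrable_gaussian_exp_moment[of "sqrt t" 2 z] t_pos
  by (subst integral_b[where f="\<lambda>x. complex_of_real (x\<^sup>2) * exp (z * complex_of_real x)"]) (auto simp: of_real_power[symmetric] simp del: of_real_power)

definition wexp :: "complex \<Rightarrow> 'a \<Rightarrow> complex" where
  "wexp c \<omega> = exp (c * complex_of_real (b \<omega>) - c\<^sup>2 * complex_of_real t / 2)"

text \<open>The product of \<open>wexp c\<close> and \<open>wexp d\<close> is exp (t c d) times
  \<open>wexp (c + d)\<close>, and weighting by the latter formally gives \<open>b\<close> the mean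
  m = t (c + d) and the variance t. The bracket is the expectation of (\<alpha> + \<beta> b)
  (\<gamma> + \<delta> b) under that law, with second moment t + m^2. The kernel is
  polynomial-exponential in all arguments; conjugation is left to its users.\<close>

definition gauss_kernel :: "complex \<Rightarrow> complex \<Rightarrow> complex \<Rightarrow> complex \<Rightarrow> complex \<Rightarrow> complex \<Rightarrow> complex" where
  "gauss_kernel c d \<alpha> \<beta> \<gamma> \<delta> =
    (\<alpha> * \<gamma> + (\<alpha> * \<delta> + \<beta> * \<gamma>) * (complex_of_real t * (c + d)) + \<beta> * \<delta> * (complex_of_real t + (complex_of_real t * (c + d))\<^sup>2)) * exp (complex_of_real t * (c * d))"

lemma
  fixes c d \<alpha> \<beta> \<gamma> \<delta> :: complex
  defines "f \<equiv> \<lambda>\<omega>. ((\<alpha> + \<beta> * complex_of_real (b \<omega>)) * wexp c \<omega>) * cnj ((\<gamma> + \<delta> * complex_of_real (b \<omega>)) * wexp d \<omega>)"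
  shows integrable_wexp_pair: "integrable M f"
    and integral_wexp_pair: "integral\<^sup>L M f = gauss_kernel c (cnj d) \<alpha> \<beta> (cnj \<gamma>) (cnj \<delta>)"
proof -
  \<comment> \<open>One factor times the conjugate of the other is the constant exp p times a single
    exponential in \<open>b\<close>, so the three exponential moments cover every term.\<close>
  define z where "z = c + cnj d"
  define p where "p = - (c\<^sup>2 + (cnj d)\<^sup>2) * complex_of_real t / 2"
  have e: "wexp c \<omega> * cnj (wexp d \<omega>) = exp p * exp (z * complex_of_real (b \<omega>))" for \<omega>
    unfolding wexp_def exp_cnj exp_add[symmetric] p_def z_def
    by (rule arg_cong[where f=exp]) (simp add: field_simps)
  have f: "f = (\<lambda>\<omega>. exp p * (\<alpha> * cnj \<gamma> * exp (z * complex_of_real (b \<omega>))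
      + (\<alpha> * cnj \<delta> + \<beta> * cnj \<gamma>) * (complex_of_real (b \<omega>) * exp (z * complex_of_real (b \<omega>)))
      + \<beta> * cnj \<delta> * (complex_of_real ((b \<omega>)\<^sup>2) * exp (z * complex_of_real (b \<omega>)))))"
  proof
    fix \<omega>
    have "f \<omega> = ((\<alpha> + \<beta> * complex_of_real (b \<omega>)) * (cnj \<gamma> + cnj \<delta> * complex_of_real (b \<omega>))) * (wexp c \<omega> * cnj (wexp d \<omega>))"
      unfolding f_def by (simp add: ac_simps)
    then show "f \<omega> = exp p * (\<alpha> * cnj \<gamma> * exp (z * complex_of_real (b \<omega>))
      + (\<alpha> * cnj \<delta> + \<beta> * cnj \<gamma>) * (complex_of_real (b \<omega>) * exp (z * complex_of_real (b \<omega>)))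
      + \<beta> * cnj \<delta> * (complex_of_real ((b \<omega>)\<^sup>2) * exp (z * complex_of_real (b \<omega>))))"
      unfolding e by (simp add: algebra_simps power2_eq_square)
  qed
  have i0: "integrable M (\<lambda>\<omega>. exp (z * complex_of_real (b \<omega>)))"
    and i1: "integrable M (\<lambda>\<omega>. complex_of_real (b \<omega>) * exp (z * complex_of_real (b \<omega>)))"
    and i2: "integrable M (\<lambda>\<omega>. complex_of_real ((b \<omega>)\<^sup>2) * exp (z * complex_of_real (b \<omega>)))"
    using integrable_exp_moment[of 0 z] integrable_exp_moment[of 1 z] integrable_exp_moment[of 2 z] by simp_all
  show "integrable M f"
    unfolding f using i0 i1 i2
    by (intro integrable_mult_right Bochner_Integration.integrable_add)
  have "integral\<^sup>L M f = exp p * (\<alpha> * cnj \<gamma> * exp (z\<^sup>2 * complex_of_real t / 2)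
      + (\<alpha> * cnj \<delta> + \<beta> * cnj \<gamma>) * (z * complex_of_real t * exp (z\<^sup>2 * complex_of_real t / 2))
      + \<beta> * cnj \<delta> * ((complex_of_real t + (z * complex_of_real t)\<^sup>2) * exp (z\<^sup>2 * complex_of_real t / 2)))"
    unfolding f using i0 i1 i2
    by (simp add: integral_exp_moment0 integral_exp_moment1 integral_exp_moment2 del: of_real_power)
  also have "\<dots> = (\<alpha> * cnj \<gamma> + (\<alpha> * cnj \<delta> + \<beta> * cnj \<gamma>) * (complex_of_real t * (c + cnj d)) + \<beta> * cnj \<delta> * (complex_of_real t + (complex_of_real t * (c + cnj d))\<^sup>2))
      * (exp p * exp (z\<^sup>2 * complex_of_real t / 2))"
    unfolding z_def by (simp add: algebra_simps)
  also have "exp p * exp (z\<^sup>2 * complex_of_real t / 2) = exp (complex_of_real t * (c * cnj d))"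
    unfolding exp_add[symmetric] p_def z_def
    by (rule arg_cong[where f=exp]) (simp add: field_simps power2_eq_square)
  finally show "integral\<^sup>L M f = gauss_kernel c (cnj d) \<alpha> \<beta> (cnj \<gamma>) (cnj \<delta>)"
    unfolding gauss_kernel_def .
qed

text \<open>A common shape for V, D V, (B - g) V and their rotated versions over the same list:
  \<open>\<kappa>\<close> moves the exponents, while \<open>\<alpha>\<close> and
  \<open>\<beta>\<close> give an affine factor in \<open>b\<close> that may depend on the exponent.
  Equations between inner products then reduce to kernel identities for each pair of entries.
  Summation runs over positions since a list may repeat an entry.\<close>

definition poly_exp_sum ::
  "(complex \<Rightarrow> complex) \<Rightarrow> (complex \<Rightarrow> complex) \<Rightarrow> (complex \<Rightarrow> complex) \<Rightarrow> (complex \<times> complex) list \<Rightarrow> 'a \<Rightarrow> complex" where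
  "poly_exp_sum \<kappa> \<alpha> \<beta> xs \<omega> = (\<Sum>i<length xs. fst (xs ! i) *
     ((\<alpha> (snd (xs ! i)) + \<beta> (snd (xs ! i)) * complex_of_real (b \<omega>)) * wexp (\<kappa> (snd (xs ! i))) \<omega>))"

lemma measurable_poly_exp_sum: "poly_exp_sum \<kappa> \<alpha> \<beta> xs \<in> borel_measurable M"
  unfolding poly_exp_sum_def[abs_def] wexp_def by measurable

lemma
  shows integrable_poly_exp_sum_pair:
    "integrable M (\<lambda>\<omega>. poly_exp_sum \<kappa> \<alpha> \<beta> xs \<omega> * cnj (poly_exp_sum \<kappa>' \<gamma> \<delta> xs \<omega>))"
    and integral_poly_exp_sum_pair:
    "(\<integral>\<omega>. poly_exp_sum \<kappa> \<alpha> \<beta> xs \<omega> * cnj (poly_exp_sum \<kappa>' \<gamma> \<delta> xs \<omega>) \<partial>M) =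
     (\<Sum>i<length xs. \<Sum>j<length xs. fst (xs ! i) * cnj (fst (xs ! j)) *
        gauss_kernel (\<kappa> (snd (xs ! i))) (cnj (\<kappa>' (snd (xs ! j)))) (\<alpha> (snd (xs ! i))) (\<beta> (snd (xs ! i)))
          (cnj (\<gamma> (snd (xs ! j)))) (cnj (\<delta> (snd (xs ! j)))))"
proof -
  have eq: "poly_exp_sum \<kappa> \<alpha> \<beta> xs \<omega> * cnj (poly_exp_sum \<kappa>' \<gamma> \<delta> xs \<omega>) =
    (\<Sum>i<length xs. \<Sum>j<length xs. fst (xs ! i) * cnj (fst (xs ! j)) *
      (((\<alpha> (snd (xs ! i)) + \<beta> (snd (xs ! i)) * complex_of_real (b \<omega>)) * wexp (\<kappa> (snd (xs ! i))) \<omega>) *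
       cnj ((\<gamma> (snd (xs ! j)) + \<delta> (snd (xs ! j)) * complex_of_real (b \<omega>)) * wexp (\<kappa>' (snd (xs ! j))) \<omega>)))" for \<omega>
    unfolding poly_exp_sum_def cnj_sum sum_product
    by (intro sum.cong refl) (simp add: ac_simps)
  note int = integrable_wexp_pair
  show "integrable M (\<lambda>\<omega>. poly_exp_sum \<kappa> \<alpha> \<beta> xs \<omega> * cnj (poly_exp_sum \<kappa>' \<gamma> \<delta> xs \<omega>))"
    unfolding eq by (intro Bochner_Integration.integrable_sum integrable_mult_right int)
  show "(\<integral>\<omega>. poly_exp_sum \<kappa> \<alpha> \<beta> xs \<omega> * cnj (poly_exp_sum \<kappa>' \<gamma> \<delta> xs \<omega>) \<partial>M) =
     (\<Sum>i<length xs. \<Sum>j<length xs. fst (xs ! i) * cnj (fst (xs ! j)) *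
        gauss_kernel (\<kappa> (snd (xs ! i))) (cnj (\<kappa>' (snd (xs ! j)))) (\<alpha> (snd (xs ! i))) (\<beta> (snd (xs ! i)))
          (cnj (\<gamma> (snd (xs ! j)))) (cnj (\<delta> (snd (xs ! j)))))"
    unfolding eq
    by (subst Bochner_Integration.integral_sum, intro Bochner_Integration.integrable_sum integrable_mult_right int,
        intro sum.cong refl,
        subst Bochner_Integration.integral_sum, intro integrable_mult_right int,
        intro sum.cong refl, subst integral_mult_right_zero, subst integral_wexp_pair, rule refl)
qed

lemma sq_int_poly_exp_sum: "sq_int M (poly_exp_sum \<kappa> \<alpha> \<beta> xs)"
proof -
  have "integrable M (\<lambda>\<omega>. Re (poly_exp_sum \<kappa> \<alpha> \<beta> xs \<omega> * cnj (poly_exp_sum \<kappa> \<alpha> \<beta> xs \<omega>)))"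
    by (rule integrable_Re[OF integrable_poly_exp_sum_pair])
  then show ?thesis
    unfolding sq_int_def complex_norm_square[symmetric]
    using measurable_poly_exp_sum by (simp add: complex_norm_square[symmetric] flip: of_real_power)
qed

lemma poly_exp_sum_mult:
  "(p + q * complex_of_real (b \<omega>)) * poly_exp_sum \<kappa> (\<lambda>c. 1) (\<lambda>c. 0) xs \<omega> = poly_exp_sum \<kappa> (\<lambda>c. p) (\<lambda>c. q) xs \<omega>"
  unfolding poly_exp_sum_def sum_distrib_left
  by (intro sum.cong refl) (simp add: algebra_simps)

text \<open>In the notation of the paper, the three sums are \<open>D_t\<^sup>* V = B_t V - D_t V\<close>, \<open>D_t V\<close> and \<open>V\<close>.\<close>

lemma l2n_creation:
  "(l2n M (poly_exp_sum (\<lambda>c. c) (\<lambda>c. - (c * complex_of_real t)) (\<lambda>c. 1) xs))\<^sup>2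
    = (l2n M (poly_exp_sum (\<lambda>c. c) (\<lambda>c. c * complex_of_real t) (\<lambda>c. 0) xs))\<^sup>2
      + t * (l2n M (poly_exp_sum (\<lambda>c. c) (\<lambda>c. 1) (\<lambda>c. 0) xs))\<^sup>2"
proof -
  have "complex_of_real ((l2n M (poly_exp_sum (\<lambda>c. c) (\<lambda>c. - (c * complex_of_real t)) (\<lambda>c. 1) xs))\<^sup>2)
    = complex_of_real ((l2n M (poly_exp_sum (\<lambda>c. c) (\<lambda>c. c * complex_of_real t) (\<lambda>c. 0) xs))\<^sup>2)
      + complex_of_real t * complex_of_real ((l2n M (poly_exp_sum (\<lambda>c. c) (\<lambda>c. 1) (\<lambda>c. 0) xs))\<^sup>2)"
    unfolding l2n_square_eq_integral integral_poly_exp_sum_pair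
      sum_distrib_left sum.distrib[symmetric]
    by (intro sum.cong refl) (simp add: gauss_kernel_def algebra_simps power2_eq_square)
  then show ?thesis
    by (simp only: of_real_mult[symmetric] of_real_add[symmetric] of_real_eq_iff)
qed

text \<open>The Fourier-type map \<open>E_c \<mapsto> E_{-ic}\<close> carries \<open>-i (D_t - D_t\<^sup>*) = -i (2 D_t - B_t)\<close> to
  multiplication by \<open>B_t\<close>, isometrically.\<close>

lemma l2n_rotated:
  fixes g :: real
  shows "l2n M (poly_exp_sum (\<lambda>c. - \<i> * c) (\<lambda>c. - complex_of_real g) (\<lambda>c. 1) xs)
    = l2n M (poly_exp_sum (\<lambda>c. c) (\<lambda>c. - (2 * \<i> * complex_of_real t * c) - complex_of_real g) (\<lambda>c. \<i>) xs)"
proof -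
  \<comment> \<open>Rotating both exponents leaves \<open>c * cnj d\<close> unchanged, so the
    exponential factors of the two kernels agree and a polynomial identity remains for each pair of
    entries.\<close>
  have "complex_of_real ((l2n M (poly_exp_sum (\<lambda>c. - \<i> * c) (\<lambda>c. - complex_of_real g) (\<lambda>c. 1) xs))\<^sup>2)
    = complex_of_real ((l2n M (poly_exp_sum (\<lambda>c. c) (\<lambda>c. - (2 * \<i> * complex_of_real t * c) - complex_of_real g) (\<lambda>c. \<i>) xs))\<^sup>2)"
    unfolding l2n_square_eq_integral integral_poly_exp_sum_pair
    by (intro sum.cong refl) (simp add: gauss_kernel_def algebra_simps power2_eq_square)
  then show ?thesis
    by (simp only: of_real_eq_iff power2_eq_iff_nonneg l2n_nonneg)
qed

text \<open>Robertson's inequality for \<open>B_t\<close> and \<open>P = -i (2 D_t - B_t)\<close>: the commutator is \<open>[B_t, P] = 2 i t\<close>.\<close>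

lemma uncertainty_poly_exp_sum:
  fixes g g' :: real
  shows "t * (l2n M (poly_exp_sum (\<lambda>c. c) (\<lambda>c. 1) (\<lambda>c. 0) xs))\<^sup>2
    \<le> l2n M (poly_exp_sum (\<lambda>c. c) (\<lambda>c. - complex_of_real g) (\<lambda>c. 1) xs)
      * l2n M (poly_exp_sum (\<lambda>c. - \<i> * c) (\<lambda>c. - complex_of_real g') (\<lambda>c. 1) xs)"
proof -
  define F where "F = poly_exp_sum (\<lambda>c. c) (\<lambda>c. - complex_of_real g) (\<lambda>c. 1) xs"
  define H where "H = poly_exp_sum (\<lambda>c. c) (\<lambda>c. - (2 * \<i> * complex_of_real t * c) - complex_of_real g') (\<lambda>c. \<i>) xs"
  define n where "n = (l2n M (poly_exp_sum (\<lambda>c. c) (\<lambda>c. 1) (\<lambda>c. 0) xs))\<^sup>2"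
  have F: "sq_int M F" and H: "sq_int M H"
    unfolding F_def H_def by (rule sq_int_poly_exp_sum)+
  \<comment> \<open>F and H are (B - g) V and (P - g') V. Since B and P are symmetric on these sums,
    the real shifts g and g' cancel in the difference of the two inner products, and only the
    commutator is left.\<close>
  have "(\<integral>\<omega>. F \<omega> * cnj (H \<omega>) \<partial>M) - (\<integral>\<omega>. H \<omega> * cnj (F \<omega>) \<partial>M) = - 2 * \<i> * complex_of_real t * complex_of_real n"
    unfolding n_def F_def H_def l2n_square_eq_integral integral_poly_exp_sum_pair
      sum_distrib_left sum_subtractf[symmetric]
    by (intro sum.cong refl) (simp add: gauss_kernel_def algebra_simps power2_eq_square)
  then have "cmod (- 2 * \<i> * complex_of_real t * complex_of_real n) \<le> cmod (\<integral>\<omega>. F \<omega> * cnj (H \<omega>) \<partial>M) + cmod (\<integral>\<omega>. H \<omega> * cnj (F \<omega>) \<partial>M)"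
    by (metis norm_triangle_ineq4)
  also have "\<dots> \<le> l2n M F * l2n M H + l2n M H * l2n M F"
    by (intro add_mono l2n_Cauchy_Schwarz F H)
  finally have "2 * (t * n) \<le> 2 * (l2n M F * l2n M H)"
    using t_pos by (simp add: norm_mult norm_power n_def)
  then show ?thesis
    unfolding n_def F_def H_def l2n_rotated by simp
qed

end

section \<open>The uncertainty inequality at a fixed time\<close>

lemma std_BM_prob_space: "std_BM M T B \<Longrightarrow> prob_space M"
  and std_BM_measurable: "std_BM M T B \<Longrightarrow> t \<in> {0..T} \<Longrightarrow> B t \<in> borel_measurable M"
  unfolding std_BM_def by auto

text \<open>The definition of \<open>std_BM\<close> fixes the laws of increments; that of
  \<open>B t\<close> follows because \<open>B 0\<close> vanishes almost surely. Time 0 is excluded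
  since the law degenerates there.\<close>

lemma std_BM_gaussian_rv:
  assumes BM: "std_BM M T B" and t: "0 < t" "t \<le> T"
  shows "gaussian_rv M (B t) t"
proof -
  interpret prob_space M by (rule std_BM_prob_space[OF BM])
  have [measurable]: "B t \<in> borel_measurable M" "B 0 \<in> borel_measurable M"
    using t by (auto intro!: std_BM_measurable[OF BM])
  have D: "distributed M lborel (\<lambda>\<omega>. B t \<omega> - B 0 \<omega>) (\<lambda>x. ennreal (normal_density 0 (sqrt (t - 0)) x))"
    using BM t unfolding std_BM_def by blast
  have "AE \<omega> in M. B 0 \<omega> = 0" using BM unfolding std_BM_def by blast
  then have "distr M lborel (B t) = distr M lborel (\<lambda>\<omega>. B t \<omega> - B 0 \<omega>)"
    by (intro distr_cong_AE) auto
  then have "distributed M lborel (B t) (\<lambda>x. ennreal (normal_density 0 (sqrt t) x))"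
    using D unfolding distributed_def by simp
  then show ?thesis
    by unfold_locales (use t in auto)
qed

text \<open>The counterpart of G on representing lists; acting on lists makes it well defined
  without any independence of the exponentials.\<close>

definition rot_list :: "(complex \<times> complex) list \<Rightarrow> (complex \<times> complex) list" where
  "rot_list = map (\<lambda>(a, c). (a, - \<i> * c))"

text \<open>\<open>xs @ neg_list ys\<close> represents a difference. The distance between two
  members of an approximating sequence thus becomes the norm of a single list, to which the a priori
  bounds apply.\<close>

definition neg_list :: "(complex \<times> complex) list \<Rightarrow> (complex \<times> complex) list" where
  "neg_list = map (\<lambda>(a, c). (- a, c))"

lemma vt_append: "vt B t (xs @ ys) \<omega> = vt B t xs \<omega> + vt B t ys \<omega>"
  unfolding vt_def by simp

lemma vt_neg: "vt B t (neg_list xs) \<omega> = - vt B t xs \<omega>"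
  unfolding vt_def neg_list_def by (induction xs) auto

lemma dt_append: "dt B t (xs @ ys) \<omega> = dt B t xs \<omega> + dt B t ys \<omega>"
  unfolding dt_def by simp

lemma dt_neg: "dt B t (neg_list xs) \<omega> = - dt B t xs \<omega>"
  unfolding dt_def neg_list_def by (induction xs) auto

lemma rot_append: "rot_list (xs @ ys) = rot_list xs @ rot_list ys"
  unfolding rot_list_def by simp

lemma rot_neg: "rot_list (neg_list xs) = neg_list (rot_list xs)"
  unfolding rot_list_def neg_list_def by (induction xs) auto

lemma
  assumes BM: "std_BM M T B" and t: "0 < t" "t \<le> T"
  shows vt_eq_poly_exp_sum: "vt B t xs = gaussian_rv.poly_exp_sum (B t) t (\<lambda>c. c) (\<lambda>c. 1) (\<lambda>c. 0) xs"
    and dt_eq_poly_exp_sum: "dt B t xs = gaussian_rv.poly_exp_sum (B t) t (\<lambda>c. c) (\<lambda>c. c * complex_of_real t) (\<lambda>c. 0) xs"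
    and vt_rot_eq_poly_exp_sum: "vt B t (rot_list xs) = gaussian_rv.poly_exp_sum (B t) t (\<lambda>c. - \<i> * c) (\<lambda>c. 1) (\<lambda>c. 0) xs"
proof -
  interpret gaussian_rv M "B t" t by (rule std_BM_gaussian_rv[OF BM t])
  show "vt B t xs = poly_exp_sum (\<lambda>c. c) (\<lambda>c. 1) (\<lambda>c. 0) xs"
    "dt B t xs = poly_exp_sum (\<lambda>c. c) (\<lambda>c. c * complex_of_real t) (\<lambda>c. 0) xs"
    "vt B t (rot_list xs) = poly_exp_sum (\<lambda>c. - \<i> * c) (\<lambda>c. 1) (\<lambda>c. 0) xs"
    unfolding vt_def dt_def rot_list_def poly_exp_sum_def wexp_def expo_def
    by (auto simp: fun_eq_iff sum_list_sum_nth atLeast0LessThan case_prod_unfold intro!: sum.cong)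
qed

text \<open>The norm bounds come from the part \<open>N\<close> = (B - D) V: multiplication by
  \<open>B t\<close> yields N + D, its rotated counterpart i (N - D), both up to the shift by g. The
  norm identity for N bounds its norm by \<open>l2n M D + sqrt t * l2n M V\<close>, which explains
  the factor 2 and the constant \<open>sqrt t\<close>.\<close>

lemma
  assumes BM: "std_BM M T B" and t: "0 < t" "t \<le> T"
  shows sq_int_vt: "sq_int M (vt B t xs)"
    and sq_int_dt: "sq_int M (dt B t xs)"
    and sq_int_mult_vt: "sq_int M (\<lambda>\<omega>. complex_of_real (B t \<omega> - g) * vt B t xs \<omega>)"
    and l2n_mult_vt_le: "l2n M (\<lambda>\<omega>. complex_of_real (B t \<omega> - g) * vt B t xs \<omega>)
      \<le> 2 * l2n M (dt B t xs) + (sqrt t + \<bar>g\<bar>) * l2n M (vt B t xs)"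
    and l2n_mult_vt_rot_le: "l2n M (\<lambda>\<omega>. complex_of_real (B t \<omega> - g) * vt B t (rot_list xs) \<omega>)
      \<le> 2 * l2n M (dt B t xs) + (sqrt t + \<bar>g\<bar>) * l2n M (vt B t xs)"
    and uncertainty_vt: "t * (l2n M (vt B t xs))\<^sup>2
      \<le> l2n M (\<lambda>\<omega>. complex_of_real (B t \<omega> - g) * vt B t xs \<omega>)
        * l2n M (\<lambda>\<omega>. complex_of_real (B t \<omega> - g') * vt B t (rot_list xs) \<omega>)"
proof -
  interpret gaussian_rv M "B t" t by (rule std_BM_gaussian_rv[OF BM t])
  note eqs = vt_eq_poly_exp_sum[OF BM t, of xs] dt_eq_poly_exp_sum[OF BM t] vt_rot_eq_poly_exp_sum[OF BM t]
  define V where "V = poly_exp_sum (\<lambda>c. c) (\<lambda>c. 1) (\<lambda>c. 0) xs"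
  define D where "D = poly_exp_sum (\<lambda>c. c) (\<lambda>c. c * complex_of_real t) (\<lambda>c. 0) xs"
  define N where "N = poly_exp_sum (\<lambda>c. c) (\<lambda>c. - (c * complex_of_real t)) (\<lambda>c. 1) xs"
  have mult: "(\<lambda>\<omega>. complex_of_real (B t \<omega> - h) * poly_exp_sum \<kappa> (\<lambda>c. 1) (\<lambda>c. 0) ys \<omega>)
      = poly_exp_sum \<kappa> (\<lambda>c. - complex_of_real h) (\<lambda>c. 1) ys" for \<kappa> h ys
    using poly_exp_sum_mult[of "- complex_of_real h" 1 _ \<kappa> ys] by (auto simp: fun_eq_iff)
  show "sq_int M (vt B t xs)" "sq_int M (dt B t xs)"
    "sq_int M (\<lambda>\<omega>. complex_of_real (B t \<omega> - g) * vt B t xs \<omega>)"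
    unfolding eqs mult by (rule sq_int_poly_exp_sum)+
  show "t * (l2n M (vt B t xs))\<^sup>2
      \<le> l2n M (\<lambda>\<omega>. complex_of_real (B t \<omega> - g) * vt B t xs \<omega>)
        * l2n M (\<lambda>\<omega>. complex_of_real (B t \<omega> - g') * vt B t (rot_list xs) \<omega>)"
    unfolding eqs mult by (rule uncertainty_poly_exp_sum)
  have sq: "sq_int M V" "sq_int M D" "sq_int M N"
    unfolding V_def D_def N_def by (rule sq_int_poly_exp_sum)+
  have "(l2n M N)\<^sup>2 \<le> (l2n M D + sqrt t * l2n M V)\<^sup>2"
    using l2n_creation[of xs] t_pos unfolding N_def[symmetric] D_def[symmetric] V_def[symmetric]
    by (simp add: power2_sum power_mult_distrib)
  then have N: "l2n M N \<le> l2n M D + sqrt t * l2n M V"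
    by (rule power2_le_imp_le) (use t_pos in auto)
  have gV: "l2n M (\<lambda>\<omega>. complex_of_real g * V \<omega>) = \<bar>g\<bar> * l2n M V"
    by (simp add: l2n_cmult)
  have "poly_exp_sum (\<lambda>c. c) (\<lambda>c. - complex_of_real g) (\<lambda>c. 1) xs = (\<lambda>\<omega>. (N \<omega> + D \<omega>) - complex_of_real g * V \<omega>)"
    unfolding N_def D_def V_def poly_exp_sum_def sum_distrib_left sum.distrib[symmetric] sum_subtractf[symmetric]
    by (intro ext sum.cong refl) (simp add: algebra_simps)
  then have "l2n M (poly_exp_sum (\<lambda>c. c) (\<lambda>c. - complex_of_real g) (\<lambda>c. 1) xs) \<le> (l2n M N + l2n M D) + \<bar>g\<bar> * l2n M V"
    using l2n_triangle_diff[OF sq_int_add[OF sq(3,2)] sq_int_cmult[OF sq(1), of "complex_of_real g"]]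
      l2n_triangle[OF sq(3,2)] gV by simp
  then show "l2n M (\<lambda>\<omega>. complex_of_real (B t \<omega> - g) * vt B t xs \<omega>)
      \<le> 2 * l2n M (dt B t xs) + (sqrt t + \<bar>g\<bar>) * l2n M (vt B t xs)"
    unfolding eqs mult using N unfolding V_def D_def distrib_right by linarith
  have "poly_exp_sum (\<lambda>c. c) (\<lambda>c. - (2 * \<i> * complex_of_real t * c) - complex_of_real g) (\<lambda>c. \<i>) xs
      = (\<lambda>\<omega>. \<i> * (N \<omega> - D \<omega>) - complex_of_real g * V \<omega>)"
    unfolding N_def D_def V_def poly_exp_sum_def sum_distrib_left sum_subtractf[symmetric]
    by (intro ext sum.cong refl) (simp add: algebra_simps)
  then have "l2n M (poly_exp_sum (\<lambda>c. - \<i> * c) (\<lambda>c. - complex_of_real g) (\<lambda>c. 1) xs) \<le> (l2n M N + l2n M D) + \<bar>g\<bar> * l2n M V"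
    unfolding l2n_rotated
    using l2n_triangle_diff[OF sq_int_cmult[OF sq_int_diff[OF sq(3,2)], of \<i>] sq_int_cmult[OF sq(1), of "complex_of_real g"]]
      l2n_triangle_diff[OF sq(3,2)] gV l2n_cmult[of M \<i> "\<lambda>\<omega>. N \<omega> - D \<omega>"] by simp
  then show "l2n M (\<lambda>\<omega>. complex_of_real (B t \<omega> - g) * vt B t (rot_list xs) \<omega>)
      \<le> 2 * l2n M (dt B t xs) + (sqrt t + \<bar>g\<bar>) * l2n M (vt B t xs)"
    unfolding eqs mult using N unfolding V_def D_def distrib_right by linarith
qed

section \<open>Extension to the domain of the closed operator\<close>

lemma l2_limit_Cauchy:
  assumes X: "\<And>n. sq_int M (Xs n)" "sq_int M X" and conv: "(\<lambda>n. l2n M (\<lambda>x. Xs n x - X x)) \<longlonglongrightarrow> 0" and e: "0 < e"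
  shows "\<exists>N. \<forall>m\<ge>N. \<forall>n\<ge>N. l2n M (\<lambda>x. Xs n x - Xs m x) \<le> e"
proof -
  obtain N where N: "\<And>n. N \<le> n \<Longrightarrow> l2n M (\<lambda>x. Xs n x - X x) < e / 2"
    using LIMSEQ_D[OF conv, of "e / 2"] e by auto
  have "l2n M (\<lambda>x. Xs n x - Xs m x) \<le> e" if "N \<le> m" "N \<le> n" for m n
    using l2n_triangle_diff[OF sq_int_diff[OF X(1)[of n] X(2)] sq_int_diff[OF X(1)[of m] X(2)]] N[OF that(1)] N[OF that(2)]
    by simp
  then show ?thesis by blast
qed

lemma vt_limit_in_Hspace:
  assumes "t \<in> {0..T}" "sq_int M X" "L2conv M (\<lambda>n. vt B t (xss n)) X"
  shows "X \<in> Hspace M B T"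
proof -
  have eq: "vt B t xs = v_all B (map (\<lambda>(a, c). (a, c, t)) xs)" for xs
    unfolding vt_def v_all_def by (simp add: comp_def case_prod_unfold)
  show ?thesis
    using assms unfolding Hspace_def
    by (auto intro!: exI[of _ "\<lambda>n. map (\<lambda>(a, c). (a, c, t)) (xss n)"] simp: eq[symmetric] split: prod.splits)
qed

lemma vt_in_Hspace:
  assumes BM: "std_BM M T B" and t: "0 < t" "t \<le> T"
  shows "vt B t xs \<in> Hspace M B T"
  using t by (intro vt_limit_in_Hspace[where xss="\<lambda>_. xs" and t=t] sq_int_vt[OF BM t]) (auto simp: L2conv_def)

text \<open>G acts on representatives and is linear only up to null sets. Induction over the list
  meets finitely many exceptional sets.\<close>

lemma G_vt:
  assumes G_exp: "\<forall>c. \<forall>t\<in>{0..T}. AE \<omega> in M. G (expo B c t) \<omega> = expo B (- \<i> * c) t \<omega>"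
    and G_lin: "\<forall>X\<in>Hspace M B T. \<forall>Z\<in>Hspace M B T. \<forall>a b.
                  AE \<omega> in M. G (\<lambda>\<omega>. a * X \<omega> + b * Z \<omega>) \<omega> = a * G X \<omega> + b * G Z \<omega>"
    and BM: "std_BM M T B" and t: "0 < t" "t \<le> T"
  shows "AE \<omega> in M. G (vt B t xs) \<omega> = vt B t (rot_list xs) \<omega>"
proof (induction xs)
  case Nil
  have H: "vt B t [] \<in> Hspace M B T" by (rule vt_in_Hspace[OF BM t])
  \<comment> \<open>Zero coefficients in the linearity of G give G 0 = 0 almost everywhere.\<close>
  have "AE \<omega> in M. G (\<lambda>\<omega>. 0 * vt B t [] \<omega> + 0 * vt B t [] \<omega>) \<omega> = 0 * G (vt B t []) \<omega> + 0 * G (vt B t []) \<omega>"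
    using G_lin H by blast
  then show ?case by (simp add: vt_def rot_list_def)
next
  case (Cons x xs)
  obtain a c where x: "x = (a, c)" by (cases x)
  have "expo B c t = vt B t [(1, c)]" by (simp add: vt_def)
  then have H: "expo B c t \<in> Hspace M B T" "vt B t xs \<in> Hspace M B T"
    using vt_in_Hspace[OF BM t] by simp_all
  have "AE \<omega> in M. G (\<lambda>\<omega>. a * expo B c t \<omega> + 1 * vt B t xs \<omega>) \<omega> = a * G (expo B c t) \<omega> + 1 * G (vt B t xs) \<omega>"
    using G_lin H by blast
  moreover have "AE \<omega> in M. G (expo B c t) \<omega> = expo B (- \<i> * c) t \<omega>"
    using G_exp t by simp
  ultimately show ?case using Cons
  proof eventually_elim
    case (elim \<omega>)
    have "vt B t (x # xs) = (\<lambda>\<omega>. a * expo B c t \<omega> + 1 * vt B t xs \<omega>)"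
      unfolding vt_def x by simp
    then show ?case using elim unfolding vt_def x rot_list_def by simp
  qed
qed

text \<open>Isometry is stated for single elements; applied to the difference, which must itself lie
  in \<open>Hspace\<close>, it becomes a statement on distances through the almost everywhere
  linearity of G.\<close>

lemma G_diff_isometry:
  assumes G_maps: "\<forall>X\<in>Hspace M B T. G X \<in> Hspace M B T"
    and G_lin: "\<forall>X\<in>Hspace M B T. \<forall>Z\<in>Hspace M B T. \<forall>a b.
                  AE \<omega> in M. G (\<lambda>\<omega>. a * X \<omega> + b * Z \<omega>) \<omega> = a * G X \<omega> + b * G Z \<omega>"
    and G_isom: "\<forall>X\<in>Hspace M B T.
                  integral\<^sup>L M (\<lambda>\<omega>. (cmod (G X \<omega>))\<^sup>2) = integral\<^sup>L M (\<lambda>\<omega>. (cmod (X \<omega>))\<^sup>2)"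
    and X: "X \<in> Hspace M B T" and Z: "Z \<in> Hspace M B T" and XZ: "(\<lambda>\<omega>. X \<omega> - Z \<omega>) \<in> Hspace M B T"
  shows "l2n M (\<lambda>\<omega>. G X \<omega> - G Z \<omega>) = l2n M (\<lambda>\<omega>. X \<omega> - Z \<omega>)"
proof -
  have m: "G U \<in> borel_measurable M" if "U \<in> Hspace M B T" for U
    using G_maps that unfolding Hspace_def sq_int_def by auto
  have "AE \<omega> in M. G (\<lambda>\<omega>. 1 * X \<omega> + (- 1) * Z \<omega>) \<omega> = 1 * G X \<omega> + (- 1) * G Z \<omega>"
    using G_lin X Z by blast
  then have "AE \<omega> in M. G (\<lambda>\<omega>. X \<omega> - Z \<omega>) \<omega> = G X \<omega> - G Z \<omega>" by simp
  then have "l2n M (G (\<lambda>\<omega>. X \<omega> - Z \<omega>)) = l2n M (\<lambda>\<omega>. G X \<omega> - G Z \<omega>)"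
    using m[OF X] m[OF Z] m[OF XZ] by (intro l2n_cong_AE) auto
  then show ?thesis
    using G_isom XZ unfolding l2n_def by auto
qed

text \<open>Lists approximating U in the graph of D have Cauchy images under D, so by the a priori
  bounds their products with B - g, and those of the rotated lists with B - g', are Cauchy too.
  Closedness of multiplication identifies the limits, all norms converge, and the inequality for
  lists passes to the limit.\<close>

lemma uncertainty_dom_D:
  assumes BM: "std_BM M T B" and t: "0 < t" "t \<le> T"
    and G_exp: "\<forall>c. \<forall>t\<in>{0..T}. AE \<omega> in M. G (expo B c t) \<omega> = expo B (- \<i> * c) t \<omega>"
    and G_maps: "\<forall>X\<in>Hspace M B T. G X \<in> Hspace M B T"
    and G_lin: "\<forall>X\<in>Hspace M B T. \<forall>Z\<in>Hspace M B T. \<forall>a b.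
                  AE \<omega> in M. G (\<lambda>\<omega>. a * X \<omega> + b * Z \<omega>) \<omega> = a * G X \<omega> + b * G Z \<omega>"
    and G_isom: "\<forall>X\<in>Hspace M B T.
                  integral\<^sup>L M (\<lambda>\<omega>. (cmod (G X \<omega>))\<^sup>2) = integral\<^sup>L M (\<lambda>\<omega>. (cmod (X \<omega>))\<^sup>2)"
    and U: "U \<in> dom_D M B t"
  shows "sq_int M (\<lambda>\<omega>. complex_of_real (B t \<omega> - g) * U \<omega>)"
    and "sq_int M (\<lambda>\<omega>. complex_of_real (B t \<omega> - g') * G U \<omega>)"
    and "t * (l2n M U)\<^sup>2 \<le> l2n M (\<lambda>\<omega>. complex_of_real (B t \<omega> - g) * U \<omega>)
        * l2n M (\<lambda>\<omega>. complex_of_real (B t \<omega> - g') * G U \<omega>)"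
proof -
  interpret prob_space M by (rule std_BM_prob_space[OF BM])
  have tT: "t \<in> {0..T}" using t by simp
  have [measurable]: "B t \<in> borel_measurable M" using tT by (rule std_BM_measurable[OF BM])
  note sq_vt = sq_int_vt[OF BM t] and sq_dt = sq_int_dt[OF BM t]
  obtain Z xss where UZ: "sq_int M U" "sq_int M Z"
    and "L2conv M (\<lambda>n. vt B t (xss n)) U" "L2conv M (\<lambda>n. dt B t (xss n)) Z"
    using U unfolding dom_D_def D_graph_def by blast
  then have cU: "(\<lambda>n. l2n M (\<lambda>\<omega>. vt B t (xss n) \<omega> - U \<omega>)) \<longlonglongrightarrow> 0"
    and cZ: "(\<lambda>n. l2n M (\<lambda>\<omega>. dt B t (xss n) \<omega> - Z \<omega>)) \<longlonglongrightarrow> 0"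
    by (simp_all add: L2conv_iff_l2n sq_vt sq_dt)
  define W where "W n = vt B t (rot_list (xss n))" for n
  have HU: "U \<in> Hspace M B T"
    by (rule vt_limit_in_Hspace[OF tT UZ(1)]) fact
  have sqGU: "sq_int M (G U)"
    using G_maps HU unfolding Hspace_def by auto
  have HV: "vt B t xs \<in> Hspace M B T" for xs by (rule vt_in_Hspace[OF BM t])
  have sqGV: "sq_int M (G (vt B t xs))" for xs
    using G_maps HV[of xs] unfolding Hspace_def by auto
  \<comment> \<open>The difference is approximated by the lists
    \<open>xss n @ neg_list (xss k)\<close> with n fixed and k growing.\<close>
  have HVU: "(\<lambda>\<omega>. vt B t (xss n) \<omega> - U \<omega>) \<in> Hspace M B T" for n
  proof (rule vt_limit_in_Hspace[OF tT sq_int_diff[OF sq_vt UZ(1)]])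
    have "(\<lambda>\<omega>. vt B t (xss n @ neg_list (xss k)) \<omega> - (vt B t (xss n) \<omega> - U \<omega>)) = (\<lambda>\<omega>. U \<omega> - vt B t (xss k) \<omega>)" for k
      by (simp add: vt_append vt_neg)
    then have "(\<lambda>k. l2n M (\<lambda>\<omega>. vt B t (xss n @ neg_list (xss k)) \<omega> - (vt B t (xss n) \<omega> - U \<omega>))) \<longlonglongrightarrow> 0"
      using cU by (simp add: l2n_minus_commute)
    then show "L2conv M (\<lambda>k. vt B t (xss n @ neg_list (xss k))) (\<lambda>\<omega>. vt B t (xss n) \<omega> - U \<omega>)"
      by (subst L2conv_iff_l2n) (auto intro: sq_vt sq_int_diff UZ)
  qed
  \<comment> \<open>Isometry makes the rotated lists approach \<open>G U\<close> exactly as fast as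
    the lists approach U.\<close>
  have W_eq: "l2n M (\<lambda>\<omega>. W n \<omega> - G U \<omega>) = l2n M (\<lambda>\<omega>. vt B t (xss n) \<omega> - U \<omega>)" for n
  proof -
    have "AE \<omega> in M. G (vt B t (xss n)) \<omega> = W n \<omega>"
      unfolding W_def by (rule G_vt[OF G_exp G_lin BM t])
    then have "l2n M (\<lambda>\<omega>. W n \<omega> - G U \<omega>) = l2n M (\<lambda>\<omega>. G (vt B t (xss n)) \<omega> - G U \<omega>)"
      using sq_int_measurable[OF sqGU] sq_int_measurable[OF sqGV] sq_int_measurable[OF sq_vt]
      by (intro l2n_cong_AE) (auto simp: W_def intro!: borel_measurable_diff)
    also have "\<dots> = l2n M (\<lambda>\<omega>. vt B t (xss n) \<omega> - U \<omega>)"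
      by (rule G_diff_isometry[OF G_maps G_lin G_isom HV HU HVU])
    finally show ?thesis .
  qed
  then have cW: "(\<lambda>n. l2n M (\<lambda>\<omega>. W n \<omega> - G U \<omega>)) \<longlonglongrightarrow> 0" using cU by simp
  \<comment> \<open>This is the right-hand side of both a priori bounds, so one estimate serves the
    original and the rotated sequence. The thresholds e / 4 and e / (2 C) leave at most e / 2 for
    each summand.\<close>
  have cau: "\<exists>N. \<forall>m\<ge>N. \<forall>n\<ge>N. 2 * l2n M (dt B t (xss n @ neg_list (xss m))) +
      (sqrt t + \<bar>h\<bar>) * l2n M (vt B t (xss n @ neg_list (xss m))) \<le> e" if e: "0 < e" for h e :: real
  proof -
    define C where "C = sqrt t + \<bar>h\<bar> + 1"
    have C: "0 < C" "sqrt t + \<bar>h\<bar> \<le> C" using t unfolding C_def by (auto intro: add_nonneg_pos)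
    have "0 < e / 4" "0 < e / (2 * C)" using C e by auto
    then obtain N1 N2 where N1: "\<And>m n. N1 \<le> m \<Longrightarrow> N1 \<le> n \<Longrightarrow> l2n M (\<lambda>\<omega>. dt B t (xss n) \<omega> - dt B t (xss m) \<omega>) \<le> e / 4"
      and N2: "\<And>m n. N2 \<le> m \<Longrightarrow> N2 \<le> n \<Longrightarrow> l2n M (\<lambda>\<omega>. vt B t (xss n) \<omega> - vt B t (xss m) \<omega>) \<le> e / (2 * C)"
      using l2_limit_Cauchy[OF sq_dt UZ(2) cZ] l2_limit_Cauchy[OF sq_vt UZ(1) cU] by metis
    have eqs: "dt B t (xss n @ neg_list (xss m)) = (\<lambda>\<omega>. dt B t (xss n) \<omega> - dt B t (xss m) \<omega>)"
      "vt B t (xss n @ neg_list (xss m)) = (\<lambda>\<omega>. vt B t (xss n) \<omega> - vt B t (xss m) \<omega>)" for m n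
      by (simp_all add: fun_eq_iff dt_append dt_neg vt_append vt_neg)
    have "2 * l2n M (dt B t (xss n @ neg_list (xss m))) +
      (sqrt t + \<bar>h\<bar>) * l2n M (vt B t (xss n @ neg_list (xss m))) \<le> e"
      if "max N1 N2 \<le> m" "max N1 N2 \<le> n" for m n
    proof -
      have "(sqrt t + \<bar>h\<bar>) * l2n M (vt B t (xss n @ neg_list (xss m))) \<le> C * (e / (2 * C))"
        using that N2 C unfolding eqs by (intro mult_mono) auto
      also have "\<dots> = e / 2" using C by simp
      finally show ?thesis using N1[of m n] that unfolding eqs by simp
    qed
    then show ?thesis by blast
  qed
  have mV: "sq_int M (\<lambda>\<omega>. complex_of_real (B t \<omega> - h) * vt B t xs \<omega>)" for h xs
    by (rule sq_int_mult_vt[OF BM t])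
  have closeV: "\<exists>N. \<forall>m\<ge>N. \<forall>n\<ge>N. l2n M (\<lambda>\<omega>. complex_of_real (B t \<omega> - g) * vt B t (xss n) \<omega>
      - complex_of_real (B t \<omega> - g) * vt B t (xss m) \<omega>) \<le> e" if "0 < e" for e
  proof -
    have eq: "(\<lambda>\<omega>. complex_of_real (B t \<omega> - g) * vt B t (xss n) \<omega> - complex_of_real (B t \<omega> - g) * vt B t (xss m) \<omega>)
      = (\<lambda>\<omega>. complex_of_real (B t \<omega> - g) * vt B t (xss n @ neg_list (xss m)) \<omega>)" for m n
      by (simp add: fun_eq_iff vt_append vt_neg algebra_simps)
    show ?thesis
      unfolding eq using cau[OF that, of g] l2n_mult_vt_le[OF BM t, of g] by (meson order_trans)
  qed
  have closeW: "\<exists>N. \<forall>m\<ge>N. \<forall>n\<ge>N. l2n M (\<lambda>\<omega>. complex_of_real (B t \<omega> - g') * W n \<omega>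
      - complex_of_real (B t \<omega> - g') * W m \<omega>) \<le> e" if "0 < e" for e
  proof -
    have eq: "(\<lambda>\<omega>. complex_of_real (B t \<omega> - g') * W n \<omega> - complex_of_real (B t \<omega> - g') * W m \<omega>)
      = (\<lambda>\<omega>. complex_of_real (B t \<omega> - g') * vt B t (rot_list (xss n @ neg_list (xss m))) \<omega>)" for m n
      by (simp add: fun_eq_iff W_def rot_append rot_neg vt_append vt_neg algebra_simps)
    show ?thesis
      unfolding eq using cau[OF that, of g'] l2n_mult_vt_rot_le[OF BM t, of g'] by (meson order_trans)
  qed
  have m: "(\<lambda>\<omega>. complex_of_real (B t \<omega> - h)) \<in> borel_measurable M" for h by measurable
  note limU = l2_closed_multiplication[OF sq_vt UZ(1) cU m mV closeV]
  have sqW: "sq_int M (W n)" "sq_int M (\<lambda>\<omega>. complex_of_real (B t \<omega> - g') * W n \<omega>)" for n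
    unfolding W_def by (rule sq_vt, rule mV)
  note limW = l2_closed_multiplication[OF sqW(1) sqGU cW m sqW(2) closeW]
  show s1: "sq_int M (\<lambda>\<omega>. complex_of_real (B t \<omega> - g) * U \<omega>)" by (rule limU(1))
  show s2: "sq_int M (\<lambda>\<omega>. complex_of_real (B t \<omega> - g') * G U \<omega>)" by (rule limW(1))
  have "(\<lambda>n. t * (l2n M (vt B t (xss n)))\<^sup>2) \<longlonglongrightarrow> t * (l2n M U)\<^sup>2"
    by (intro tendsto_intros l2n_LIMSEQ[OF sq_vt UZ(1) cU])
  moreover have "(\<lambda>n. l2n M (\<lambda>\<omega>. complex_of_real (B t \<omega> - g) * vt B t (xss n) \<omega>)
      * l2n M (\<lambda>\<omega>. complex_of_real (B t \<omega> - g') * W n \<omega>))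
    \<longlonglongrightarrow> l2n M (\<lambda>\<omega>. complex_of_real (B t \<omega> - g) * U \<omega>) * l2n M (\<lambda>\<omega>. complex_of_real (B t \<omega> - g') * G U \<omega>)"
    by (intro tendsto_intros l2n_LIMSEQ[OF mV s1 limU(2)] l2n_LIMSEQ[OF sqW(2) s2 limW(2)])
  ultimately show "t * (l2n M U)\<^sup>2 \<le> l2n M (\<lambda>\<omega>. complex_of_real (B t \<omega> - g) * U \<omega>)
        * l2n M (\<lambda>\<omega>. complex_of_real (B t \<omega> - g') * G U \<omega>)"
    by (rule LIMSEQ_le) (use uncertainty_vt[OF BM t] in \<open>auto simp: W_def\<close>)
qed

section \<open>Independent increments and the Ito isometry\<close>

lemma nat_filt_space [simp]: "space (nat_filt M B s) = space M"
  and nat_filt_sets: "sets (nat_filt M B s)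
    = sigma_sets (space M) {B u -` A \<inter> space M | u A. u \<in> {0..s} \<and> A \<in> sets borel}"
proof -
  have *: "{B u -` A \<inter> space M | u A. u \<in> {0..s} \<and> A \<in> sets borel} \<subseteq> Pow (space M)" by auto
  show "space (nat_filt M B s) = space M" unfolding nat_filt_def by (rule space_measure_of[OF *])
  show "sets (nat_filt M B s) = sigma_sets (space M) {B u -` A \<inter> space M | u A. u \<in> {0..s} \<and> A \<in> sets borel}"
    unfolding nat_filt_def by (rule sets_measure_of[OF *])
qed

lemma nat_filt_mono:
  assumes "s \<le> t" "f \<in> borel_measurable (nat_filt M B s)"
  shows "f \<in> borel_measurable (nat_filt M B t)"
proof -
  have "sets (nat_filt M B s) \<subseteq> sets (nat_filt M B t)"
    unfolding nat_filt_sets using assms(1) by (intro sigma_sets_mono') fastforce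
  then show ?thesis
    using assms(2) unfolding measurable_def by auto
qed

lemma nat_filt_measurable_BM:
  assumes "0 \<le> u" "u \<le> s"
  shows "B u \<in> borel_measurable (nat_filt M B s)"
  by (rule measurableI) (use assms in \<open>auto simp: nat_filt_sets\<close>)

lemma nat_filt_measurable:
  assumes BM: "std_BM M T B" and s: "s \<le> T" and f: "f \<in> borel_measurable (nat_filt M B s)"
  shows "f \<in> borel_measurable M"
proof -
  have "sets (nat_filt M B s) \<subseteq> sets M"
    unfolding nat_filt_sets
    using s by (intro sets.sigma_sets_subset) (auto intro!: measurable_sets std_BM_measurable[OF BM])
  then show ?thesis
    using f unfolding measurable_def by auto
qed

text \<open>Independence is given for the increments along one sorted list, so the times in J are
  merged with 0 and s and followed by t. Each \<open>B u - B 0\<close> is then a partial sum of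
  increments up to s, while \<open>B t - B s\<close> is the last increment.\<close>

lemma std_BM_indep_cylinder:
  assumes BM: "std_BM M T B" and st: "0 \<le> s" "s \<le> t" "t \<le> T"
    and J: "finite J" "J \<subseteq> {0..s}" and E: "\<And>u. E u \<in> sets borel" and F: "F \<in> sets borel"
  shows "measure M ({\<omega>\<in>space M. \<forall>u\<in>J. B u \<omega> \<in> E u} \<inter> {\<omega>\<in>space M. B t \<omega> - B s \<omega> \<in> F})
    = measure M {\<omega>\<in>space M. \<forall>u\<in>J. B u \<omega> \<in> E u} * measure M {\<omega>\<in>space M. B t \<omega> - B s \<omega> \<in> F}"
proof -
  interpret prob_space M by (rule std_BM_prob_space[OF BM])
  define us where "us = sorted_list_of_set (insert 0 (insert s J))"
  \<comment> \<open>\<open>us\<close> has n + 1 points and \<open>ts\<close> has n + 1 increments: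
    those with index below n lie within {0..s}, and index n is the one from s to t. If s = t, the
    point s occurs twice in \<open>ts\<close>, which sortedness permits.\<close>
  define n where "n = length us - 1"
  define ts where "ts = us @ [t]"
  have set_us: "set us = insert 0 (insert s J)" and sorted_us: "sorted us" and us_ne: "us \<noteq> []"
  proof -
    have fin: "finite (insert 0 (insert s J))" using J by simp
    show set_us: "set us = insert 0 (insert s J)"
      unfolding us_def by (rule set_sorted_list_of_set[OF fin])
    show "sorted us" unfolding us_def by (rule sorted_sorted_list_of_set)
    show "us \<noteq> []" using set_us by auto
  qed
  have len: "length us = Suc n" "length ts - 1 = Suc n"
    using us_ne unfolding n_def ts_def by auto
  have us0: "us ! 0 = 0"
  proof -
    have "us ! 0 \<in> set us" using us_ne by (cases us) auto
    then have "0 \<le> us ! 0" using set_us J st by auto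
    moreover obtain i where "i < length us" "us ! i = 0" using set_us by (metis in_set_conv_nth insertI1)
    then have "us ! 0 \<le> 0" using sorted_nth_mono[OF sorted_us, of 0 i] by auto
    ultimately show ?thesis by simp
  qed
  have usn: "us ! n = s"
  proof -
    have "us ! n \<in> set us" using len by auto
    then have "us ! n \<le> s" using set_us J st by auto
    moreover obtain i where "i < length us" "us ! i = s" using set_us by (metis in_set_conv_nth insertI1 insertI2)
    then have "s \<le> us ! n" using sorted_nth_mono[OF sorted_us, of i n] len by auto
    ultimately show ?thesis by simp
  qed
  have us_T: "u \<in> {0..T}" if "u \<in> set us" for u
    using that set_us J st by auto
  have [measurable]: "B u \<in> borel_measurable M" if "u \<in> set us" for u
    using us_T[OF that] by (rule std_BM_measurable[OF BM])
  have Bt[measurable]: "B t \<in> borel_measurable M" "B s \<in> borel_measurable M" "B 0 \<in> borel_measurable M"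
    using st by (auto intro!: std_BM_measurable[OF BM])
  have t0: "t \<in> {0..T}" using st by simp
  have "u \<le> t" if "u \<in> set us" for u using that set_us J st by auto
  then have "sorted ts" using sorted_us unfolding ts_def by (simp add: sorted_append)
  moreover have "set ts \<subseteq> {0..T}"
    unfolding ts_def set_append by (rule Un_least[OF subsetI]) (use us_T t0 in auto)
  ultimately have "indep_vars (\<lambda>_. borel) (\<lambda>i \<omega>. B (ts ! Suc i) \<omega> - B (ts ! i) \<omega>) {..<length ts - 1}"
    using BM unfolding std_BM_def by blast
  then have ind: "indep_vars (\<lambda>_. borel) (\<lambda>i \<omega>. B (ts ! Suc i) \<omega> - B (ts ! i) \<omega>) {..<Suc n}"
    unfolding len .
  define X where "X i \<omega> = B (ts ! Suc i) \<omega> - B (ts ! i) \<omega>" for i \<omega>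
  have Xn: "X n \<omega> = B t \<omega> - B s \<omega>" for \<omega>
    unfolding X_def ts_def using len usn by (simp add: nth_append)
  have sumX: "(\<Sum>i<j. X i \<omega>) = B (us ! j) \<omega> - B 0 \<omega>" if "j \<le> n" for j \<omega>
  proof -
    have "(\<Sum>i<j. X i \<omega>) = B (ts ! j) \<omega> - B (ts ! 0) \<omega>"
      unfolding X_def by (rule sum_lessThan_telescope)
    then show ?thesis using that len us0 unfolding ts_def by (simp add: nth_append)
  qed
  \<comment> \<open>The cylinder event as a condition on the vector of the first n increments, whose
    partial sum up to j is \<open>B (us ! j) - B 0\<close>.\<close>
  define S where "S = {f \<in> space (PiM {..<n} (\<lambda>_. borel :: real measure)). \<forall>j\<in>{..n}. us ! j \<in> J \<longrightarrow> (\<Sum>i<j. f i) \<in> E (us ! j)}"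
  define R where "R = {f \<in> space (PiM {n} (\<lambda>_. borel :: real measure)). f n \<in> F}"
  have S: "S \<in> sets (PiM {..<n} (\<lambda>_. borel))"
  proof -
    have m: "(\<lambda>f. \<Sum>i<j. f i) \<in> borel_measurable (PiM {..<n} (\<lambda>_. borel :: real measure))" if "j \<le> n" for j
      using that by (intro borel_measurable_sum measurable_component_singleton) auto
    have "{f \<in> space (PiM {..<n} (\<lambda>_. borel :: real measure)). us ! j \<in> J \<longrightarrow> (\<Sum>i<j. f i) \<in> E (us ! j)} \<in> sets (PiM {..<n} (\<lambda>_. borel))"
      if "j \<in> {..n}" for j
      using measurable_sets[OF m E, of j "us ! j"] that
      by (cases "us ! j \<in> J") (auto simp: vimage_def Int_def conj_commute)
    then show ?thesis
      unfolding S_def by (intro sets.sets_Collect_finite_All) auto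
  qed
  have R: "R \<in> sets (PiM {n} (\<lambda>_. borel))"
  proof -
    have "(\<lambda>f. f n) \<in> borel_measurable (PiM {n} (\<lambda>_. borel :: real measure))" by measurable
    from measurable_sets[OF this F] show ?thesis
      unfolding R_def by (simp add: vimage_def Int_def conj_commute)
  qed
  have ind2: "indep_var (PiM {..<n} (\<lambda>_. borel)) (\<lambda>\<omega>. restrict (\<lambda>i. X i \<omega>) {..<n}) (PiM {n} (\<lambda>_. borel)) (\<lambda>\<omega>. restrict (\<lambda>i. X i \<omega>) {n})"
    unfolding X_def by (rule indep_var_restrict[OF ind]) auto
  have prod: "prob {\<omega>\<in>space M. (\<forall>j\<in>{..n}. us ! j \<in> J \<longrightarrow> B (us ! j) \<omega> - B 0 \<omega> \<in> E (us ! j)) \<and> B t \<omega> - B s \<omega> \<in> F}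
    = prob {\<omega>\<in>space M. \<forall>j\<in>{..n}. us ! j \<in> J \<longrightarrow> B (us ! j) \<omega> - B 0 \<omega> \<in> E (us ! j)} * prob {\<omega>\<in>space M. B t \<omega> - B s \<omega> \<in> F}"
  proof -
    have sm: "(\<Sum>i<j. (\<lambda>i\<in>{..<n}. X i \<omega>) i) = B (us ! j) \<omega> - B 0 \<omega>" if "j \<le> n" for j \<omega>
    proof -
      have "(\<Sum>i<j. (\<lambda>i\<in>{..<n}. X i \<omega>) i) = (\<Sum>i<j. X i \<omega>)" using that by (intro sum.cong) auto
      then show ?thesis using sumX[OF that] by simp
    qed
    have 1: "(\<lambda>\<omega>. restrict (\<lambda>i. X i \<omega>) {..<n}) -` S \<inter> space M
      = {\<omega>\<in>space M. \<forall>j\<in>{..n}. us ! j \<in> J \<longrightarrow> B (us ! j) \<omega> - B 0 \<omega> \<in> E (us ! j)}"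
      unfolding S_def using sm by (auto simp: space_PiM)
    have 2: "(\<lambda>\<omega>. restrict (\<lambda>i. X i \<omega>) {n}) -` R \<inter> space M = {\<omega>\<in>space M. B t \<omega> - B s \<omega> \<in> F}"
      unfolding R_def using Xn by (auto simp: space_PiM)
    have 3: "(\<lambda>x. (\<lambda>i\<in>{..<n}. X i x, \<lambda>i\<in>{n}. X i x)) -` (S \<times> R) \<inter> space M =
      ((\<lambda>\<omega>. restrict (\<lambda>i. X i \<omega>) {..<n}) -` S \<inter> space M) \<inter> ((\<lambda>\<omega>. restrict (\<lambda>i. X i \<omega>) {n}) -` R \<inter> space M)"
      by auto
    show ?thesis
      using indep_varD[OF ind2 S R] unfolding 3 1 2
      by (simp add: Int_def conj_ac Collect_conj_eq[symmetric] cong: conj_cong)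
  qed
  \<comment> \<open>The increments see only \<open>B u - B 0\<close>; replacing it by
    \<open>B u\<close> changes the events by a null set.\<close>
  have AE0: "AE \<omega> in M. B 0 \<omega> = 0" using BM unfolding std_BM_def by blast
  have J_iff: "(\<forall>u\<in>J. P u) \<longleftrightarrow> (\<forall>j\<in>{..n}. us ! j \<in> J \<longrightarrow> P (us ! j))" for P
  proof -
    have "\<exists>j\<in>{..n}. us ! j = u" if "u \<in> J" for u
      using that set_us len by (metis atMost_iff in_set_conv_nth insertI2 less_Suc_eq_le)
    then show ?thesis by blast
  qed
  have BJ[measurable]: "B u \<in> borel_measurable M" if "u \<in> J" for u
    using that J st by (intro std_BM_measurable[OF BM]) auto
  have E1: "{\<omega>\<in>space M. f \<omega> \<in> A} \<in> events" if "f \<in> borel_measurable M" "A \<in> sets borel" for f :: "'a \<Rightarrow> real" and A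
    using measurable_sets[OF that] by (simp add: vimage_def Int_def conj_commute)
  have a: "{\<omega>\<in>space M. \<forall>u\<in>J. B u \<omega> \<in> E u} \<in> events"
    by (intro sets.sets_Collect_finite_All E1 BJ E J)
  have a': "{\<omega>\<in>space M. \<forall>u\<in>J. B u \<omega> - B 0 \<omega> \<in> E u} \<in> events"
    by (intro sets.sets_Collect_finite_All E1 borel_measurable_diff BJ Bt E J)
  have d: "{\<omega>\<in>space M. B t \<omega> - B s \<omega> \<in> F} \<in> events"
    by (intro E1 borel_measurable_diff Bt F)
  have pa: "prob {\<omega>\<in>space M. \<forall>u\<in>J. B u \<omega> \<in> E u} = prob {\<omega>\<in>space M. \<forall>u\<in>J. B u \<omega> - B 0 \<omega> \<in> E u}"
    by (rule finite_measure_eq_AE[OF _ a a']) (use AE0 in \<open>auto elim: eventually_mono\<close>)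
  have pad: "prob ({\<omega>\<in>space M. \<forall>u\<in>J. B u \<omega> \<in> E u} \<inter> {\<omega>\<in>space M. B t \<omega> - B s \<omega> \<in> F})
    = prob ({\<omega>\<in>space M. \<forall>u\<in>J. B u \<omega> - B 0 \<omega> \<in> E u} \<inter> {\<omega>\<in>space M. B t \<omega> - B s \<omega> \<in> F})"
    by (rule finite_measure_eq_AE[OF _ sets.Int[OF a d] sets.Int[OF a' d]]) (use AE0 in \<open>auto elim: eventually_mono\<close>)
  have int: "{\<omega>\<in>space M. \<forall>u\<in>J. B u \<omega> - B 0 \<omega> \<in> E u} \<inter> {\<omega>\<in>space M. B t \<omega> - B s \<omega> \<in> F}
    = {\<omega>\<in>space M. (\<forall>u\<in>J. B u \<omega> - B 0 \<omega> \<in> E u) \<and> B t \<omega> - B s \<omega> \<in> F}" by auto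
  show ?thesis
    unfolding pa pad int unfolding J_iff by (rule prod)
qed

text \<open>Cylinders over finitely many times are stable under intersection and include the
  generators of the filtration, so the product rule extends to the generated sigma-algebras. The
  function h covers both squared and complex-valued increments.\<close>

lemma std_BM_indep_increment:
  fixes X :: "'a \<Rightarrow> 'b::topological_space" and h :: "real \<Rightarrow> 'b"
  assumes BM: "std_BM M T B" and st: "0 \<le> s" "s \<le> t" "t \<le> T"
    and X: "X \<in> borel_measurable (nat_filt M B s)" and h: "h \<in> borel_measurable borel"
  shows "prob_space.indep_var M borel X borel (\<lambda>\<omega>. h (B t \<omega> - B s \<omega>))"
proof -
  interpret prob_space M by (rule std_BM_prob_space[OF BM])
  have Bt[measurable]: "B t \<in> borel_measurable M" "B s \<in> borel_measurable M"
    using st by (auto intro!: std_BM_measurable[OF BM])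
  define \<A> where "\<A> = {{\<omega>\<in>space M. \<forall>u\<in>J. B u \<omega> \<in> E u} | J E. finite J \<and> J \<subseteq> {0..s} \<and> (\<forall>u. E u \<in> sets (borel :: real measure))}"
  define \<D> where "\<D> = {(\<lambda>\<omega>. B t \<omega> - B s \<omega>) -` F \<inter> space M | F. F \<in> sets borel}"
  have BJ: "B u \<in> borel_measurable M" if "u \<in> {0..s}" for u
    using that st by (intro std_BM_measurable[OF BM]) auto
  have A_events: "\<A> \<subseteq> events"
  proof
    fix a assume "a \<in> \<A>"
    then obtain J E where a: "a = {\<omega>\<in>space M. \<forall>u\<in>J. B u \<omega> \<in> E u}" and J: "finite J" "J \<subseteq> {0..s}"
      and E: "\<And>u. E u \<in> sets (borel :: real measure)" unfolding \<A>_def by blast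
    have "{\<omega>\<in>space M. B u \<omega> \<in> E u} \<in> events" if "u \<in> J" for u
      using measurable_sets[OF BJ E, of u u] that J by (auto simp: vimage_def Int_def conj_commute)
    then show "a \<in> events" unfolding a using J by (intro sets.sets_Collect_finite_All) auto
  qed
  have D_events: "\<D> \<subseteq> events"
    unfolding \<D>_def by (auto intro!: measurable_sets)
  have "indep_set \<A> \<D>"
    unfolding indep_sets2_eq
  proof (intro conjI ballI A_events D_events)
    fix a d assume "a \<in> \<A>" "d \<in> \<D>"
    then obtain J E F where a: "a = {\<omega>\<in>space M. \<forall>u\<in>J. B u \<omega> \<in> E u}" and J: "finite J" "J \<subseteq> {0..s}"
      and E: "\<And>u. E u \<in> sets (borel :: real measure)" and F: "F \<in> sets borel"
      and d: "d = (\<lambda>\<omega>. B t \<omega> - B s \<omega>) -` F \<inter> space M" unfolding \<A>_def \<D>_def by blast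
    have d': "d = {\<omega>\<in>space M. B t \<omega> - B s \<omega> \<in> F}" unfolding d by auto
    show "prob (a \<inter> d) = prob a * prob d"
      unfolding a d' by (rule std_BM_indep_cylinder[OF BM st J E F])
  qed
  moreover have "Int_stable \<A>"
  proof (rule Int_stableI)
    fix a a' assume "a \<in> \<A>" "a' \<in> \<A>"
    then obtain J E J' E' where a: "a = {\<omega>\<in>space M. \<forall>u\<in>J. B u \<omega> \<in> E u}" "finite J" "J \<subseteq> {0..s}" "\<forall>u. E u \<in> sets (borel :: real measure)"
      and a': "a' = {\<omega>\<in>space M. \<forall>u\<in>J'. B u \<omega> \<in> E' u}" "finite J'" "J' \<subseteq> {0..s}" "\<forall>u. E' u \<in> sets (borel :: real measure)"
      unfolding \<A>_def by blast
    \<comment> \<open>Filling up with UNIV outside J and J' makes the intersection a single cylinder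
      over the union of the index sets.\<close>
    define E'' where "E'' u = (if u \<in> J then E u else UNIV) \<inter> (if u \<in> J' then E' u else UNIV)" for u
    have "a \<inter> a' = {\<omega>\<in>space M. \<forall>u\<in>J \<union> J'. B u \<omega> \<in> E'' u}"
      unfolding a(1) a'(1) E''_def by (auto split: if_splits)
    moreover have "\<forall>u. E'' u \<in> sets borel" unfolding E''_def using a(4) a'(4) by auto
    ultimately show "a \<inter> a' \<in> \<A>"
      unfolding \<A>_def using a(2,3) a'(2,3) by (intro CollectI exI[of _ "J \<union> J'"] exI[of _ E'']) auto
  qed
  moreover have "Int_stable \<D>"
  proof (rule Int_stableI)
    fix d d' assume "d \<in> \<D>" "d' \<in> \<D>"
    then obtain F F' where "d = (\<lambda>\<omega>. B t \<omega> - B s \<omega>) -` F \<inter> space M" "F \<in> sets borel"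
      "d' = (\<lambda>\<omega>. B t \<omega> - B s \<omega>) -` F' \<inter> space M" "F' \<in> sets borel" unfolding \<D>_def by blast
    then show "d \<inter> d' \<in> \<D>" unfolding \<D>_def by (intro CollectI exI[of _ "F \<inter> F'"]) auto
  qed
  ultimately have ind: "indep_set (sigma_sets (space M) \<A>) (sigma_sets (space M) \<D>)"
    by (rule indep_set_sigma_sets)
  have "{B u -` A \<inter> space M | u A. u \<in> {0..s} \<and> A \<in> sets borel} \<subseteq> \<A>"
  proof
    fix x assume "x \<in> {B u -` A \<inter> space M | u A. u \<in> {0..s} \<and> A \<in> sets borel}"
    then obtain u A where "x = B u -` A \<inter> space M" "u \<in> {0..s}" "A \<in> sets borel" by blast
    then show "x \<in> \<A>" unfolding \<A>_def by (intro CollectI exI[of _ "{u}"] exI[of _ "\<lambda>_. A"]) auto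
  qed
  then have "sets (nat_filt M B s) \<subseteq> sigma_sets (space M) \<A>"
    unfolding nat_filt_sets by (rule sigma_sets_mono')
  moreover have "X -` A \<inter> space M \<in> sets (nat_filt M B s)" if "A \<in> sets borel" for A
    using measurable_sets[OF X that] by simp
  ultimately have "{X -` A \<inter> space M | A. A \<in> sets borel} \<subseteq> sigma_sets (space M) \<A>" by blast
  then have sub: "sigma_sets (space M) {X -` A \<inter> space M | A. A \<in> sets borel} \<subseteq> sigma_sets (space M) \<A>"
    by (rule sigma_sets_mono)
  have mX: "random_variable borel X"
    using st by (intro nat_filt_measurable[OF BM _ X]) auto
  have "{(\<lambda>\<omega>. h (B t \<omega> - B s \<omega>)) -` A \<inter> space M | A. A \<in> sets borel} \<subseteq> sigma_sets (space M) \<D>"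
  proof
    fix x assume "x \<in> {(\<lambda>\<omega>. h (B t \<omega> - B s \<omega>)) -` A \<inter> space M | A. A \<in> sets borel}"
    then obtain A where A: "A \<in> sets borel" and x: "x = (\<lambda>\<omega>. h (B t \<omega> - B s \<omega>)) -` A \<inter> space M" by blast
    have "h -` A \<in> sets borel" using measurable_sets[OF h A] by simp
    then have "x \<in> \<D>" unfolding \<D>_def x by (intro CollectI exI[of _ "h -` A"]) auto
    then show "x \<in> sigma_sets (space M) \<D>" by (rule sigma_sets.Basic)
  qed
  then have sub': "sigma_sets (space M) {(\<lambda>\<omega>. h (B t \<omega> - B s \<omega>)) -` A \<inter> space M | A. A \<in> sets borel}
      \<subseteq> sigma_sets (space M) \<D>"
    by (rule sigma_sets_mono)
  have "indep_set (sigma_sets (space M) {X -` A \<inter> space M | A. A \<in> sets borel})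
      (sigma_sets (space M) {(\<lambda>\<omega>. h (B t \<omega> - B s \<omega>)) -` A \<inter> space M | A. A \<in> sets borel})"
    using ind sub sub' unfolding indep_sets2_eq by blast
  moreover have "random_variable borel (\<lambda>\<omega>. h (B t \<omega> - B s \<omega>))"
    by (rule measurable_compose[OF _ h]) measurable
  ultimately show ?thesis
    unfolding indep_var_eq using mX by simp
qed

text \<open>These are the exponential moments at z = 0. For s = t the increment is identically 0 and
  has no density, hence the case split.\<close>

lemma
  assumes BM: "std_BM M T B" and st: "0 \<le> s" "s \<le> t" "t \<le> T"
  shows integrable_increment: "integrable M (\<lambda>\<omega>. B t \<omega> - B s \<omega>)"
    and integral_increment: "(\<integral>\<omega>. B t \<omega> - B s \<omega> \<partial>M) = 0"
    and integrable_increment_square: "integrable M (\<lambda>\<omega>. (B t \<omega> - B s \<omega>)\<^sup>2)"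
    and integral_increment_square: "(\<integral>\<omega>. (B t \<omega> - B s \<omega>)\<^sup>2 \<partial>M) = t - s"
proof -
  interpret prob_space M by (rule std_BM_prob_space[OF BM])
  have "integrable M (\<lambda>\<omega>. B t \<omega> - B s \<omega>) \<and> (\<integral>\<omega>. B t \<omega> - B s \<omega> \<partial>M) = 0 \<and>
    integrable M (\<lambda>\<omega>. (B t \<omega> - B s \<omega>)\<^sup>2) \<and> (\<integral>\<omega>. (B t \<omega> - B s \<omega>)\<^sup>2 \<partial>M) = t - s"
  proof (cases "s = t")
    case False
    then have "distributed M lborel (\<lambda>\<omega>. B t \<omega> - B s \<omega>) (\<lambda>x. ennreal (normal_density 0 (sqrt (t - s)) x))"
      using BM st unfolding std_BM_def by auto
    then interpret gaussian_rv M "\<lambda>\<omega>. B t \<omega> - B s \<omega>" "t - s"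
      using False st by unfold_locales auto
    have i: "integrable M (\<lambda>\<omega>. complex_of_real (B t \<omega> - B s \<omega>))" "integrable M (\<lambda>\<omega>. complex_of_real ((B t \<omega> - B s \<omega>)\<^sup>2))"
      using integrable_exp_moment[of 1 0] integrable_exp_moment[of 2 0] by (simp_all del: of_real_diff of_real_power)
    have "(\<integral>\<omega>. complex_of_real (B t \<omega> - B s \<omega>) \<partial>M) = 0" "(\<integral>\<omega>. complex_of_real ((B t \<omega> - B s \<omega>)\<^sup>2) \<partial>M) = complex_of_real (t - s)"
      using integral_exp_moment1[of 0] integral_exp_moment2[of 0] by (simp_all del: of_real_diff of_real_power)
    then show ?thesis
      using i[THEN integrable_Re] by (simp del: of_real_diff of_real_power)
  qed simp
  then show "integrable M (\<lambda>\<omega>. B t \<omega> - B s \<omega>)" "(\<integral>\<omega>. B t \<omega> - B s \<omega> \<partial>M) = 0"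
    "integrable M (\<lambda>\<omega>. (B t \<omega> - B s \<omega>)\<^sup>2)" "(\<integral>\<omega>. (B t \<omega> - B s \<omega>)\<^sup>2 \<partial>M) = t - s" by auto
qed

text \<open>Independence from the past makes the products integrable and factorises their moments.
  The mean-zero part asks for integrability only, as it will be applied to a product of two square
  integrable functions.\<close>

lemma
  assumes BM: "std_BM M T B" and st: "0 \<le> s" "s \<le> t" "t \<le> T"
    and \<xi>: "\<xi> \<in> borel_measurable (nat_filt M B s)"
  shows sq_int_mult_increment: "sq_int M \<xi> \<Longrightarrow> sq_int M (\<lambda>\<omega>. \<xi> \<omega> * complex_of_real (B t \<omega> - B s \<omega>))"
    and l2n_mult_increment: "sq_int M \<xi> \<Longrightarrow>
      (l2n M (\<lambda>\<omega>. \<xi> \<omega> * complex_of_real (B t \<omega> - B s \<omega>)))\<^sup>2 = (l2n M \<xi>)\<^sup>2 * (t - s)"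
    and integral_mult_increment: "integrable M \<xi> \<Longrightarrow> (\<integral>\<omega>. \<xi> \<omega> * complex_of_real (B t \<omega> - B s \<omega>) \<partial>M) = 0"
proof -
  interpret prob_space M by (rule std_BM_prob_space[OF BM])
  have [measurable]: "B t \<in> borel_measurable M" "B s \<in> borel_measurable M"
    using st by (auto intro!: std_BM_measurable[OF BM])
  have [measurable]: "\<xi> \<in> borel_measurable M"
    using st by (intro nat_filt_measurable[OF BM _ \<xi>]) auto
  have eq: "(cmod (\<xi> \<omega> * complex_of_real (B t \<omega> - B s \<omega>)))\<^sup>2 = (cmod (\<xi> \<omega>))\<^sup>2 * (B t \<omega> - B s \<omega>)\<^sup>2" for \<omega>
    unfolding norm_mult norm_of_real power_mult_distrib power2_abs ..
  have \<xi>2: "(\<lambda>\<omega>. (cmod (\<xi> \<omega>))\<^sup>2) \<in> borel_measurable (nat_filt M B s)"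
    using \<xi> by measurable
  have ind2: "indep_var borel (\<lambda>\<omega>. (cmod (\<xi> \<omega>))\<^sup>2) borel (\<lambda>\<omega>. (B t \<omega> - B s \<omega>)\<^sup>2)"
    by (rule std_BM_indep_increment[OF BM st \<xi>2]) measurable
  show "sq_int M (\<lambda>\<omega>. \<xi> \<omega> * complex_of_real (B t \<omega> - B s \<omega>))" if "sq_int M \<xi>"
    unfolding sq_int_def eq
    using indep_var_integrable[OF ind2 sq_int_integrable[OF that] integrable_increment_square[OF BM st]]
    by simp
  show "(l2n M (\<lambda>\<omega>. \<xi> \<omega> * complex_of_real (B t \<omega> - B s \<omega>)))\<^sup>2 = (l2n M \<xi>)\<^sup>2 * (t - s)" if "sq_int M \<xi>"
    unfolding l2n_square eq
      indep_var_lebesgue_integral[OF ind2 sq_int_integrable[OF that] integrable_increment_square[OF BM st]]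
      integral_increment_square[OF BM st] ..
  have ind1: "indep_var borel \<xi> borel (\<lambda>\<omega>. complex_of_real (B t \<omega> - B s \<omega>))"
    by (rule std_BM_indep_increment[OF BM st \<xi>]) measurable
  have i: "integrable M (\<lambda>\<omega>. complex_of_real (B t \<omega> - B s \<omega>))"
    using integrable_increment[OF BM st] by (rule integrable_of_real)
  have z: "(\<integral>\<omega>. complex_of_real (B t \<omega> - B s \<omega>) \<partial>M) = 0"
    using integral_increment[OF BM st] by (simp del: of_real_diff)
  show "(\<integral>\<omega>. \<xi> \<omega> * complex_of_real (B t \<omega> - B s \<omega>) \<partial>M) = 0" if "integrable M \<xi>"
    using indep_var_lebesgue_integral[OF ind1 that i] z by simp
qed

section \<open>Simple integrands and the isometry in the limit\<close>

lemma valid_partition_bounds: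
  assumes "valid_partition T ts" "k < length ts - 1"
  shows "0 \<le> ts ! k" "ts ! k \<le> ts ! Suc k" "ts ! Suc k \<le> T"
proof -
  have s: "sorted ts" and l: "2 \<le> length ts" and h: "hd ts = 0" "last ts = T"
    using assms unfolding valid_partition_def by auto
  have "ts ! 0 = 0" "ts ! (length ts - 1) = T"
    using h l hd_conv_nth[of ts] last_conv_nth[of ts] by fastforce+
  then show "0 \<le> ts ! k" "ts ! k \<le> ts ! Suc k" "ts ! Suc k \<le> T"
    using sorted_nth_mono[OF s, of 0 k] sorted_nth_mono[OF s, of k "Suc k"]
      sorted_nth_mono[OF s, of "Suc k" "length ts - 1"] assms(2) by auto
qed

lemma valid_partition_mono:
  assumes "valid_partition T ts" "i \<le> j" "j < length ts"
  shows "ts ! i \<le> ts ! j"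
  using assms sorted_nth_mono unfolding valid_partition_def by blast

text \<open>Cross terms vanish: all factors other than the later increment are known when it starts,
  and that increment is centred and independent of them. The diagonal terms factorise.\<close>

lemma
  assumes BM: "std_BM M T B" and S: "simple_adapted M B T ts \<xi>"
  shows sq_int_simple_int: "sq_int M (simple_int B ts \<xi>)"
    and l2n_simple_int: "(l2n M (simple_int B ts \<xi>))\<^sup>2 = (\<Sum>k<length ts - 1. (l2n M (\<xi> k))\<^sup>2 * (ts ! Suc k - ts ! k))"
proof -
  interpret prob_space M by (rule std_BM_prob_space[OF BM])
  define n where "n = length ts - 1"
  have vp: "valid_partition T ts" using S unfolding simple_adapted_def by blast
  have \<xi>: "\<xi> k \<in> borel_measurable (nat_filt M B (ts ! k))" "sq_int M (\<xi> k)" if "k < n" for k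
    using S that unfolding simple_adapted_def n_def by auto
  note tb = valid_partition_bounds[OF vp, folded n_def]
  define D where "D k \<omega> = complex_of_real (B (ts ! Suc k) \<omega> - B (ts ! k) \<omega>)" for k \<omega>
  define X where "X k \<omega> = \<xi> k \<omega> * D k \<omega>" for k \<omega>
  have sqX: "sq_int M (X k)" if "k < n" for k
    unfolding X_def D_def by (rule sq_int_mult_increment[OF BM tb[OF that] \<xi>[OF that]])
  have normX: "(l2n M (X k))\<^sup>2 = (l2n M (\<xi> k))\<^sup>2 * (ts ! Suc k - ts ! k)" if "k < n" for k
    unfolding X_def D_def by (rule l2n_mult_increment[OF BM tb[OF that] \<xi>[OF that]])
  have SI: "simple_int B ts \<xi> = (\<lambda>\<omega>. \<Sum>k<n. X k \<omega>)"
    unfolding simple_int_def X_def D_def n_def ..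
  show sq: "sq_int M (simple_int B ts \<xi>)"
    unfolding SI by (intro sq_int_sum sqX) simp
  have int: "integrable M (\<lambda>\<omega>. X k \<omega> * cnj (X l \<omega>))" if "k < n" "l < n" for k l
    by (intro sq_int_mult_integrable sqX sq_int_cnj that)
  have less: "(\<integral>\<omega>. X k \<omega> * cnj (X l \<omega>) \<partial>M) = 0" if kl: "k < l" "l < n" for k l
  proof -
    have k: "k < n" using kl by simp
    \<comment> \<open>As k < l, the earlier increment has ended when the later one starts; this
      makes \<open>X k \<omega> * cnj (\<xi> l \<omega>)\<close> measurable at time
      \<open>ts ! l\<close>.\<close>
    have le: "ts ! Suc k \<le> ts ! l"
      using kl unfolding n_def by (intro valid_partition_mono[OF vp]) auto
    have m: "\<xi> k \<in> borel_measurable (nat_filt M B (ts ! l))"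
      by (rule nat_filt_mono[OF order_trans[OF tb(2)[OF k] le] \<xi>(1)[OF k]])
    have mB: "B (ts ! Suc k) \<in> borel_measurable (nat_filt M B (ts ! l))" "B (ts ! k) \<in> borel_measurable (nat_filt M B (ts ! l))"
      using tb[OF k] le by (auto intro!: nat_filt_measurable_BM)
    have "(\<lambda>\<omega>. X k \<omega> * cnj (\<xi> l \<omega>)) \<in> borel_measurable (nat_filt M B (ts ! l))"
    proof -
      note [measurable] = m mB \<xi>(1)[OF kl(2)]
      show ?thesis unfolding X_def D_def by measurable
    qed
    moreover have "integrable M (\<lambda>\<omega>. X k \<omega> * cnj (\<xi> l \<omega>))"
      by (intro sq_int_mult_integrable sqX sq_int_cnj \<xi>(2) k kl)
    ultimately have "(\<integral>\<omega>. (X k \<omega> * cnj (\<xi> l \<omega>)) * D l \<omega> \<partial>M) = 0"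
      unfolding D_def by (intro integral_mult_increment[OF BM tb[OF kl(2)]])
    moreover have "X k \<omega> * cnj (X l \<omega>) = (X k \<omega> * cnj (\<xi> l \<omega>)) * D l \<omega>" for \<omega>
      unfolding X_def[of l] by (simp add: D_def)
    ultimately show ?thesis by (simp only:)
  qed
  have off: "(\<integral>\<omega>. X k \<omega> * cnj (X l \<omega>) \<partial>M) = 0" if "k \<noteq> l" "k < n" "l < n" for k l
  proof (cases "k < l")
    case True then show ?thesis using less that by blast
  next
    case False
    then have "(\<integral>\<omega>. X l \<omega> * cnj (X k \<omega>) \<partial>M) = 0" using less that by auto
    moreover have "(\<integral>\<omega>. X k \<omega> * cnj (X l \<omega>) \<partial>M) = cnj (\<integral>\<omega>. X l \<omega> * cnj (X k \<omega>) \<partial>M)"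
      by (subst Bochner_Integration.integral_cnj[symmetric]) (simp add: mult.commute)
    ultimately show ?thesis by simp
  qed
  have "complex_of_real ((l2n M (simple_int B ts \<xi>))\<^sup>2) = (\<integral>\<omega>. simple_int B ts \<xi> \<omega> * cnj (simple_int B ts \<xi> \<omega>) \<partial>M)"
    by (rule l2n_square_eq_integral)
  also have "\<dots> = (\<integral>\<omega>. (\<Sum>k<n. \<Sum>l<n. X k \<omega> * cnj (X l \<omega>)) \<partial>M)"
    unfolding SI cnj_sum sum_product ..
  also have "\<dots> = (\<Sum>k<n. \<Sum>l<n. (\<integral>\<omega>. X k \<omega> * cnj (X l \<omega>) \<partial>M))"
    by (subst Bochner_Integration.integral_sum, force intro: int, intro sum.cong refl,
        subst Bochner_Integration.integral_sum, auto intro: int)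
  also have "\<dots> = (\<Sum>k<n. \<Sum>l<n. if l = k then (\<integral>\<omega>. X k \<omega> * cnj (X k \<omega>) \<partial>M) else 0)"
    using off by (intro sum.cong refl) auto
  also have "\<dots> = (\<Sum>k<n. (\<integral>\<omega>. X k \<omega> * cnj (X k \<omega>) \<partial>M))" by simp
  also have "\<dots> = (\<Sum>k<n. complex_of_real ((l2n M (\<xi> k))\<^sup>2 * (ts ! Suc k - ts ! k)))"
    by (intro sum.cong refl) (simp only: l2n_square_eq_integral[symmetric] normX lessThan_iff)
  also have "\<dots> = complex_of_real (\<Sum>k<n. (l2n M (\<xi> k))\<^sup>2 * (ts ! Suc k - ts ! k))"
    by (rule of_real_sum[symmetric])
  finally show "(l2n M (simple_int B ts \<xi>))\<^sup>2 = (\<Sum>k<length ts - 1. (l2n M (\<xi> k))\<^sup>2 * (ts ! Suc k - ts ! k))"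
    unfolding n_def of_real_eq_iff .
qed

text \<open>The half-open intervals are disjoint, so at each time at most one summand is nonzero and
  the square passes inside the sum. Repeated partition points give empty intervals.\<close>

lemma cmod_simple_proc_square:
  assumes vp: "valid_partition T ts"
  shows "(cmod (simple_proc ts \<xi> t \<omega>))\<^sup>2
    = (\<Sum>k<length ts - 1. (cmod (\<xi> k \<omega>))\<^sup>2 * indicator {ts ! k<..ts ! Suc k} t)"
proof (cases "\<exists>k<length ts - 1. ts ! k < t \<and> t \<le> ts ! Suc k")
  case False
  then have "simple_proc ts \<xi> t \<omega> = 0"
    "(\<Sum>k<length ts - 1. (cmod (\<xi> k \<omega>))\<^sup>2 * indicator {ts ! k<..ts ! Suc k} t) = 0"
    unfolding simple_proc_def by (auto intro!: sum.neutral simp: indicator_def)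
  then show ?thesis by simp
next
  case True
  then obtain k where k: "k < length ts - 1" "ts ! k < t" "t \<le> ts ! Suc k" by blast
  have uniq: "ts ! j < t \<and> t \<le> ts ! Suc j \<longleftrightarrow> j = k" if "j < length ts - 1" for j
  proof
    assume j: "ts ! j < t \<and> t \<le> ts ! Suc j"
    have "k < length ts" "j < length ts" using k(1) that by linarith+
    then have "\<not> j < k" using valid_partition_mono[OF vp, of "Suc j" k] j k by auto
    moreover have "\<not> k < j" using \<open>j < length ts\<close> valid_partition_mono[OF vp, of "Suc k" j] j k that by auto
    ultimately show "j = k" by simp
  qed (use k in auto)
  have "simple_proc ts \<xi> t \<omega> = (\<Sum>j<length ts - 1. if j = k then \<xi> k \<omega> else 0)"
    unfolding simple_proc_def by (intro sum.cong refl) (auto simp: uniq)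
  moreover have "(\<Sum>j<length ts - 1. (cmod (\<xi> j \<omega>))\<^sup>2 * indicator {ts ! j<..ts ! Suc j} t)
    = (\<Sum>j<length ts - 1. if j = k then (cmod (\<xi> k \<omega>))\<^sup>2 else 0)"
    by (intro sum.cong refl) (auto simp: indicator_def uniq)
  ultimately show ?thesis using k by simp
qed

lemma nn_integral_simple_proc:
  assumes vp: "valid_partition T ts"
  shows "(\<integral>\<^sup>+t\<in>{0..T}. ennreal ((cmod (simple_proc ts \<xi> t \<omega>))\<^sup>2) \<partial>lborel)
    = ennreal (\<Sum>k<length ts - 1. (cmod (\<xi> k \<omega>))\<^sup>2 * (ts ! Suc k - ts ! k))"
proof -
  note tb = valid_partition_bounds[OF vp]
  have "(\<integral>\<^sup>+t\<in>{0..T}. ennreal ((cmod (simple_proc ts \<xi> t \<omega>))\<^sup>2) \<partial>lborel)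
    = (\<integral>\<^sup>+t. (\<Sum>k<length ts - 1. ennreal ((cmod (\<xi> k \<omega>))\<^sup>2) * indicator {ts ! k<..ts ! Suc k} t) \<partial>lborel)"
  proof (rule nn_integral_cong)
    fix t :: real
    have "(\<Sum>k<length ts - 1. ennreal ((cmod (\<xi> k \<omega>))\<^sup>2) * indicator {ts ! k<..ts ! Suc k} t) * indicator {0..T} t
      = (\<Sum>k<length ts - 1. ennreal ((cmod (\<xi> k \<omega>))\<^sup>2) * indicator {ts ! k<..ts ! Suc k} t)"
    proof -
      have "indicator {ts ! k<..ts ! Suc k} t * indicator {0..T} t = (indicator {ts ! k<..ts ! Suc k} t :: ennreal)"
        if "k < length ts - 1" for k
        using tb[OF that] by (auto simp: indicator_def)
      then show ?thesis
        unfolding sum_distrib_right by (intro sum.cong refl) (simp add: mult.assoc)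
    qed
    then show "ennreal ((cmod (simple_proc ts \<xi> t \<omega>))\<^sup>2) * indicator {0..T} t
      = (\<Sum>k<length ts - 1. ennreal ((cmod (\<xi> k \<omega>))\<^sup>2) * indicator {ts ! k<..ts ! Suc k} t)"
      unfolding cmod_simple_proc_square[OF vp]
      by (subst sum_ennreal[symmetric]) (auto simp: ennreal_mult' ennreal_indicator)
  qed
  also have "\<dots> = (\<Sum>k<length ts - 1. ennreal ((cmod (\<xi> k \<omega>))\<^sup>2) * emeasure lborel {ts ! k<..ts ! Suc k})"
    by (subst nn_integral_sum) (auto simp: nn_integral_cmult_indicator)
  also have "\<dots> = (\<Sum>k<length ts - 1. ennreal ((cmod (\<xi> k \<omega>))\<^sup>2 * (ts ! Suc k - ts ! k)))"
    using tb by (intro sum.cong refl) (auto simp: ennreal_mult)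
  also have "\<dots> = ennreal (\<Sum>k<length ts - 1. (cmod (\<xi> k \<omega>))\<^sup>2 * (ts ! Suc k - ts ! k))"
    using tb by (intro sum_ennreal) auto
  finally show ?thesis .
qed

lemma simple_ito_isometry:
  assumes BM: "std_BM M T B" and S: "simple_adapted M B T ts \<xi>"
  shows "(\<integral>\<^sup>+\<omega>. (\<integral>\<^sup>+t\<in>{0..T}. ennreal ((cmod (simple_proc ts \<xi> t \<omega>))\<^sup>2) \<partial>lborel) \<partial>M)
    = ennreal ((l2n M (simple_int B ts \<xi>))\<^sup>2)"
proof -
  have vp: "valid_partition T ts" using S unfolding simple_adapted_def by blast
  have \<xi>: "sq_int M (\<xi> k)" if "k < length ts - 1" for k
    using S that unfolding simple_adapted_def by auto
  have "(\<integral>\<^sup>+\<omega>. ennreal (\<Sum>k<length ts - 1. (cmod (\<xi> k \<omega>))\<^sup>2 * (ts ! Suc k - ts ! k)) \<partial>M)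
    = ennreal (\<integral>\<omega>. (\<Sum>k<length ts - 1. (cmod (\<xi> k \<omega>))\<^sup>2 * (ts ! Suc k - ts ! k)) \<partial>M)"
    using \<xi>[THEN sq_int_integrable] valid_partition_bounds[OF vp]
    by (intro nn_integral_eq_integral Bochner_Integration.integrable_sum AE_I2 sum_nonneg) auto
  also have "(\<integral>\<omega>. (\<Sum>k<length ts - 1. (cmod (\<xi> k \<omega>))\<^sup>2 * (ts ! Suc k - ts ! k)) \<partial>M) = (l2n M (simple_int B ts \<xi>))\<^sup>2"
    unfolding l2n_simple_int[OF BM S] using \<xi>[THEN sq_int_integrable]
    by (subst Bochner_Integration.integral_sum) (auto simp: l2n_square)
  finally show ?thesis unfolding nn_integral_simple_proc[OF vp] .
qed

lemma nn_integral_time_prob: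
  fixes T :: real
  assumes "prob_space M"
    and f: "f \<in> borel_measurable (restrict_space lborel {0..T} \<Otimes>\<^sub>M M)"
  shows "(\<integral>\<^sup>+\<omega>. (\<integral>\<^sup>+t\<in>{0..T}. f (t, \<omega>) \<partial>lborel) \<partial>M) = integral\<^sup>N (restrict_space lborel {0..T} \<Otimes>\<^sub>M M) f"
proof -
  interpret M: prob_space M by fact
  interpret L: sigma_finite_measure "restrict_space lborel {0..T}"
    by (intro sigma_finite_measure_restrict_space sigma_finite_lborel) auto
  interpret P: pair_sigma_finite "restrict_space lborel {0..T}" M ..
  have "(\<integral>\<^sup>+\<omega>. (\<integral>\<^sup>+t\<in>{0..T}. f (t, \<omega>) \<partial>lborel) \<partial>M) = (\<integral>\<^sup>+\<omega>. (\<integral>\<^sup>+t. f (t, \<omega>) \<partial>restrict_space lborel {0..T}) \<partial>M)"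
    by (subst nn_integral_restrict_space) auto
  also have "\<dots> = integral\<^sup>N (restrict_space lborel {0..T} \<Otimes>\<^sub>M M) f"
    by (rule P.nn_integral_snd[OF f])
  finally show "(\<integral>\<^sup>+\<omega>. (\<integral>\<^sup>+t\<in>{0..T}. f (t, \<omega>) \<partial>lborel) \<partial>M) = integral\<^sup>N (restrict_space lborel {0..T} \<Otimes>\<^sub>M M) f" .
qed

lemma measurable_simple_proc:
  assumes BM: "std_BM M T B" and S: "simple_adapted M B T ts \<xi>"
  shows "(\<lambda>(t, \<omega>). simple_proc ts \<xi> t \<omega>) \<in> borel_measurable (restrict_space lborel {0..T} \<Otimes>\<^sub>M M)"
proof -
  have \<xi>: "\<xi> k \<in> borel_measurable M" if "k < length ts - 1" for k
    using S that unfolding simple_adapted_def sq_int_def by auto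
  have [measurable]: "fst \<in> borel_measurable (restrict_space lborel {0..T} \<Otimes>\<^sub>M M)"
    by (rule measurable_compose[OF measurable_fst]) (auto intro: measurable_restrict_space1)
  show ?thesis
    unfolding simple_proc_def case_prod_beta'
  proof (rule borel_measurable_sum)
    fix k assume "k \<in> {..<length ts - 1}"
    then have [measurable]: "\<xi> k \<in> borel_measurable M" using \<xi> by simp
    show "(\<lambda>x. if ts ! k < fst x \<and> fst x \<le> ts ! Suc k then \<xi> k (snd x) else 0)
        \<in> borel_measurable (restrict_space lborel {0..T} \<Otimes>\<^sub>M M)"
      by measurable
  qed
qed

text \<open>On the product of time and probability space the iterated integral is one squared L2
  norm. Simple integrands converge there to H, their stochastic integrals converge to I, and the two
  sequences of norms coincide, so the limits do.\<close>

lemma ito_isometry: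
  assumes BM: "std_BM M T B" and I: "ito_integral M B T H I"
    and H: "(\<lambda>(t, \<omega>). H t \<omega>) \<in> borel_measurable (restrict_space lborel {0..T} \<Otimes>\<^sub>M M)"
    and fin: "(\<integral>\<^sup>+\<omega>. (\<integral>\<^sup>+t\<in>{0..T}. ennreal ((cmod (H t \<omega>))\<^sup>2) \<partial>lborel) \<partial>M) < \<infinity>"
  shows "(\<integral>\<^sup>+\<omega>. (\<integral>\<^sup>+t\<in>{0..T}. ennreal ((cmod (H t \<omega>))\<^sup>2) \<partial>lborel) \<partial>M) = ennreal ((l2n M I)\<^sup>2)"
proof -
  define P where "P = restrict_space lborel {0..T} \<Otimes>\<^sub>M M"
  define h where "h = (\<lambda>(t, \<omega>). H t \<omega>)"
  note ps = std_BM_prob_space[OF BM]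
  have iter: "(\<integral>\<^sup>+\<omega>. (\<integral>\<^sup>+t\<in>{0..T}. ennreal ((cmod (f t \<omega>))\<^sup>2) \<partial>lborel) \<partial>M)
      = (\<integral>\<^sup>+x. ennreal ((cmod ((\<lambda>(t, \<omega>). f t \<omega>) x))\<^sup>2) \<partial>P)"
    if "(\<lambda>(t, \<omega>). f t \<omega>) \<in> borel_measurable P" for f
    using nn_integral_time_prob[OF ps, of "\<lambda>x. ennreal ((cmod ((\<lambda>(t, \<omega>). f t \<omega>) x))\<^sup>2)" T] that
    unfolding P_def by (simp add: case_prod_beta')
  have hm: "h \<in> borel_measurable P" using H unfolding h_def P_def .
  have sqh: "sq_int P h"
    using fin hm iter[of H] unfolding h_def[symmetric] by (intro sq_int_from_nn_integral) (auto simp: h_def)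
  obtain tss \<xi>s where S: "\<And>n. simple_adapted M B T (tss n) (\<xi>s n)"
    and conv: "(\<lambda>n. \<integral>\<^sup>+\<omega>. (\<integral>\<^sup>+t\<in>{0..T}. ennreal ((cmod (simple_proc (tss n) (\<xi>s n) t \<omega> - H t \<omega>))\<^sup>2) \<partial>lborel) \<partial>M) \<longlonglongrightarrow> 0"
    and convI: "L2conv M (\<lambda>n. simple_int B (tss n) (\<xi>s n)) I" and sqI: "sq_int M I"
    using I unfolding ito_integral_def by blast
  define \<phi> where "\<phi> n = (\<lambda>(t, \<omega>). simple_proc (tss n) (\<xi>s n) t \<omega>)" for n
  have \<phi>m: "\<phi> n \<in> borel_measurable P" for n
    unfolding \<phi>_def P_def by (rule measurable_simple_proc[OF BM S])
  have iso: "(\<integral>\<^sup>+x. ennreal ((cmod (\<phi> n x))\<^sup>2) \<partial>P) = ennreal ((l2n M (simple_int B (tss n) (\<xi>s n)))\<^sup>2)" for n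
    using iter[of "simple_proc (tss n) (\<xi>s n)"] \<phi>m[of n] simple_ito_isometry[OF BM S[of n]]
    unfolding \<phi>_def by simp
  have sq\<phi>: "sq_int P (\<phi> n)" for n
    using \<phi>m iso by (intro sq_int_from_nn_integral) auto
  have eq: "l2n P (\<phi> n) = l2n M (simple_int B (tss n) (\<xi>s n))" for n
    using iso[of n] unfolding sq_int_nn_integral[OF sq\<phi>] by (simp add: power2_eq_iff_nonneg)
  have "(\<lambda>n. \<integral>\<^sup>+x. ennreal ((cmod (\<phi> n x - h x))\<^sup>2) \<partial>P) \<longlonglongrightarrow> 0"
  proof -
    have m: "(\<lambda>(t, \<omega>). simple_proc (tss n) (\<xi>s n) t \<omega> - H t \<omega>) \<in> borel_measurable P" for n
      using borel_measurable_diff[OF \<phi>m[of n] hm] unfolding \<phi>_def h_def by (simp add: case_prod_beta')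
    show ?thesis
      using conv unfolding iter[OF m] by (simp add: \<phi>_def h_def case_prod_beta')
  qed
  then have "(\<lambda>n. l2n P (\<lambda>x. \<phi> n x - h x)) \<longlonglongrightarrow> 0"
    unfolding L2conv_iff_l2n[OF sq\<phi> sqh, symmetric] L2conv_def .
  then have "(\<lambda>n. l2n P (\<phi> n)) \<longlonglongrightarrow> l2n P h"
    by (rule l2n_LIMSEQ[OF sq\<phi> sqh])
  moreover have "(\<lambda>n. l2n P (\<phi> n)) \<longlonglongrightarrow> l2n M I"
    unfolding eq using convI L2conv_iff_l2n[OF sq_int_simple_int[OF BM S] sqI]
    by (intro l2n_LIMSEQ[OF sq_int_simple_int[OF BM S] sqI]) simp
  ultimately have "l2n P h = l2n M I" by (rule LIMSEQ_unique)
  then show ?thesis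
    using iter[of H] hm sq_int_nn_integral[OF sqh] unfolding h_def by simp
qed

section \<open>Integration over time\<close>

text \<open>Continuous paths are limits of their values on ever finer time grids, and each grid
  approximation takes countably many measurable cases. Paths are continuous only almost surely, so
  the process is set to 0 on a measurable null set that contains the exceptional paths.\<close>

lemma std_BM_jointly_measurable:
  assumes BM: "std_BM M T B" and T: "0 < T"
  obtains N where "N \<in> null_sets M"
    "(\<lambda>x. if snd x \<in> N then 0 else B (fst x) (snd x)) \<in> borel_measurable (restrict_space lborel {0..T} \<Otimes>\<^sub>M M)"
proof -
  have "AE \<omega> in M. continuous_on {0..T} (\<lambda>t. B t \<omega>)"
    using BM unfolding std_BM_def by blast
  from AE_E[OF this] obtain N where N: "{\<omega>\<in>space M. \<not> continuous_on {0..T} (\<lambda>t. B t \<omega>)} \<subseteq> N"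
    "emeasure M N = 0" "N \<in> sets M" by blast
  define P where "P = restrict_space lborel {0..T} \<Otimes>\<^sub>M M"
  have [measurable]: "fst \<in> borel_measurable P"
    unfolding P_def by (rule measurable_compose[OF measurable_fst]) (auto intro: measurable_restrict_space1)
  have [measurable]: "snd \<in> measurable P M"
    unfolding P_def by (rule measurable_snd)
  have [measurable]: "N \<in> sets M" by (rule N(3))
  \<comment> \<open>The grid point i / (n + 1), clipped to {0..T} because measurability of
    \<open>B\<close> and continuity of its paths are available only there.\<close>
  define q :: "nat \<Rightarrow> int \<Rightarrow> real" where "q n i = max 0 (min T (real_of_int i / real (Suc n)))" for n i
  have q: "q n i \<in> {0..T}" for n i using T unfolding q_def by auto
  have "(\<lambda>x. if snd x \<in> N then 0 else B (fst x) (snd x)) \<in> borel_measurable P"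
  proof (rule borel_measurable_LIMSEQ_real)
    show "(\<lambda>x. if snd x \<in> N then 0 else B (q n \<lfloor>real (Suc n) * fst x\<rfloor>) (snd x)) \<in> borel_measurable P" for n
    proof (rule measurable_compose_countable[where f="\<lambda>i x. if snd x \<in> N then 0 else B (q n i) (snd x)"])
      fix i :: int
      have [measurable]: "B (q n i) \<in> borel_measurable M" by (rule std_BM_measurable[OF BM q])
      show "(\<lambda>x. if snd x \<in> N then 0 else B (q n i) (snd x)) \<in> borel_measurable P" by measurable
    next
      show "(\<lambda>x. \<lfloor>real (Suc n) * fst x\<rfloor>) \<in> P \<rightarrow>\<^sub>M count_space UNIV" by measurable
    qed
    fix x assume "x \<in> space P"
    then have x: "fst x \<in> {0..T}" "snd x \<in> space M"
      unfolding P_def by (auto simp: space_pair_measure)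
    show "(\<lambda>n. if snd x \<in> N then 0 else B (q n \<lfloor>real (Suc n) * fst x\<rfloor>) (snd x))
        \<longlonglongrightarrow> (if snd x \<in> N then 0 else B (fst x) (snd x))"
    proof (cases "snd x \<in> N")
      case False
      then have c: "continuous_on {0..T} (\<lambda>t. B t (snd x))" using N(1) x by blast
      have "(\<lambda>n. q n \<lfloor>real (Suc n) * fst x\<rfloor>) \<longlonglongrightarrow> fst x"
      proof -
        have "\<bar>real_of_int \<lfloor>real (Suc n) * fst x\<rfloor> / real (Suc n) - fst x\<bar> \<le> 1 / real (Suc n)" for n
        proof -
          have "real_of_int \<lfloor>real (Suc n) * fst x\<rfloor> / real (Suc n) - fst x
            = (real_of_int \<lfloor>real (Suc n) * fst x\<rfloor> - real (Suc n) * fst x) / real (Suc n)"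
            by (simp add: diff_divide_distrib)
          moreover have "\<bar>real_of_int \<lfloor>real (Suc n) * fst x\<rfloor> - real (Suc n) * fst x\<bar> \<le> 1" by linarith
          ultimately show ?thesis by (simp only: abs_divide abs_of_nat divide_right_mono of_nat_0_le_iff)
        qed
        then have "(\<lambda>n. real_of_int \<lfloor>real (Suc n) * fst x\<rfloor> / real (Suc n) - fst x) \<longlonglongrightarrow> 0"
          by (intro Lim_null_comparison[OF _ LIMSEQ_Suc[OF lim_1_over_n]]) auto
        then have "(\<lambda>n. real_of_int \<lfloor>real (Suc n) * fst x\<rfloor> / real (Suc n)) \<longlonglongrightarrow> fst x"
          by (rule LIM_zero_cancel)
        then have "(\<lambda>n. q n \<lfloor>real (Suc n) * fst x\<rfloor>) \<longlonglongrightarrow> max 0 (min T (fst x))"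
          unfolding q_def by (intro tendsto_intros)
        then show ?thesis using x by simp
      qed
      then have "(\<lambda>n. B (q n \<lfloor>real (Suc n) * fst x\<rfloor>) (snd x)) \<longlonglongrightarrow> B (fst x) (snd x)"
        by (rule continuous_on_tendsto_compose[OF c _ x(1)]) (simp add: q del: atLeastAtMost_iff)
      then show ?thesis using False by simp
    qed simp
  qed
  then show ?thesis
    using that[of N] N unfolding P_def by (auto simp: null_sets_def)
qed

text \<open>A law with a density has no atoms. This is what permits division by
  \<open>B t \<omega> - g t\<close>.\<close>

lemma std_BM_AE_neq:
  assumes BM: "std_BM M T B" and t: "0 < t" "t \<le> T"
  shows "AE \<omega> in M. B t \<omega> \<noteq> c"
proof -
  interpret gaussian_rv M "B t" t by (rule std_BM_gaussian_rv[OF BM t])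
  have "AE x in lborel. 0 < ennreal (normal_density 0 (sqrt t) x) \<longrightarrow> x \<noteq> c"
    using AE_lborel_singleton[of c] by (auto elim: eventually_mono)
  then show ?thesis
    by (subst distributed_AE2[OF distributed_b]) auto
qed

theorem mainTheorem15:
  fixes M :: "'a measure" and B :: "real \<Rightarrow> 'a \<Rightarrow> real" and T :: real
    and G :: "('a \<Rightarrow> complex) \<Rightarrow> ('a \<Rightarrow> complex)"
    and Y :: "real \<Rightarrow> 'a \<Rightarrow> complex" and g g' :: "real \<Rightarrow> real"
    and I I' :: "'a \<Rightarrow> complex"
  assumes T: "0 < T"
    and BM: "std_BM M T B"
    (* G is the unique unitary operator on H with G E_{c,t} = E_{-ic,t} *)
    and G_exp: "\<forall>c. \<forall>t\<in>{0..T}. AE \<omega> in M. G (expo B c t) \<omega> = expo B (- \<i> * c) t \<omega>"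
    and G_maps: "\<forall>X\<in>Hspace M B T. G X \<in> Hspace M B T"
    and G_lin: "\<forall>X\<in>Hspace M B T. \<forall>Z\<in>Hspace M B T. \<forall>a b.
                  AE \<omega> in M. G (\<lambda>\<omega>. a * X \<omega> + b * Z \<omega>) \<omega> = a * G X \<omega> + b * G Z \<omega>"
    and G_isom: "\<forall>X\<in>Hspace M B T.
                  integral\<^sup>L M (\<lambda>\<omega>. (cmod (G X \<omega>))\<^sup>2) = integral\<^sup>L M (\<lambda>\<omega>. (cmod (X \<omega>))\<^sup>2)"
    and G_onto: "\<forall>Z\<in>Hspace M B T. \<exists>X\<in>Hspace M B T. AE \<omega> in M. G X \<omega> = Z \<omega>"
    (* the process Y *)
    and Y_meas: "\<forall>t\<in>{0..T}. Y t \<in> borel_measurable (vimage_algebra (space M) (B t) borel)"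
    and Y_sq: "\<forall>t\<in>{0..T}. integrable M (\<lambda>\<omega>. (cmod (Y t \<omega>))\<^sup>2)"
    and Y_dom: "\<forall>t\<in>{0..T}. Y t \<in> dom_D M B t \<and> Y t \<in> dom_Dstar M B t \<and>
                  Y t \<in> dom_DDstar M B t \<and> Y t \<in> dom_DstarD M B t"
    and g: "g \<in> borel_measurable borel" and g': "g' \<in> borel_measurable borel"
    (* conditions for the stochastic integrals to exist *)
    and meas1: "(\<lambda>(t, \<omega>). complex_of_real (B t \<omega> - g t) * Y t \<omega>)
                  \<in> borel_measurable (restrict_space lborel {0..T} \<Otimes>\<^sub>M M)"
    and sq1: "(\<integral>\<^sup>+\<omega>. (\<integral>\<^sup>+t\<in>{0..T}. ennreal ((cmod (complex_of_real (B t \<omega> - g t) * Y t \<omega>))\<^sup>2) \<partial>lborel) \<partial>M) < \<infinity>"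
    and meas2: "(\<lambda>(t, \<omega>). complex_of_real (B t \<omega> - g' t) * G (Y t) \<omega>)
                  \<in> borel_measurable (restrict_space lborel {0..T} \<Otimes>\<^sub>M M)"
    and sq2: "(\<integral>\<^sup>+\<omega>. (\<integral>\<^sup>+t\<in>{0..T}. ennreal ((cmod (complex_of_real (B t \<omega> - g' t) * G (Y t) \<omega>))\<^sup>2) \<partial>lborel) \<partial>M) < \<infinity>"
    (* the stochastic integrals *)
    and I: "ito_integral M B T (\<lambda>t \<omega>. complex_of_real (B t \<omega> - g t) * Y t \<omega>) I"
    and I': "ito_integral M B T (\<lambda>t \<omega>. complex_of_real (B t \<omega> - g' t) * G (Y t) \<omega>) I'"
  shows "(\<integral>\<^sup>+\<omega>. (\<integral>\<^sup>+t\<in>{0..T}. ennreal (t * (cmod (Y t \<omega>))\<^sup>2) \<partial>lborel) \<partial>M)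
           \<le> ennreal (sqrt (integral\<^sup>L M (\<lambda>\<omega>. (cmod (I \<omega>))\<^sup>2))
                     * sqrt (integral\<^sup>L M (\<lambda>\<omega>. (cmod (I' \<omega>))\<^sup>2)))"
proof -
  interpret prob_space M by (rule std_BM_prob_space[OF BM])
  define L where "L = restrict_space lborel {0..T}"
  define P where "P = L \<Otimes>\<^sub>M M"
  interpret L: sigma_finite_measure L
    unfolding L_def by (intro sigma_finite_measure_restrict_space sigma_finite_lborel) auto
  interpret PP: pair_sigma_finite L M ..
  have space_L: "space L = {0..T}" unfolding L_def by simp
  have L_int: "(\<integral>\<^sup>+t\<in>{0..T}. f t \<partial>lborel) = (\<integral>\<^sup>+t. f t \<partial>L)" for f
    unfolding L_def by (subst nn_integral_restrict_space) auto
  define H where "H t \<omega> = complex_of_real (B t \<omega> - g t) * Y t \<omega>" for t \<omega>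
  define H' where "H' t \<omega> = complex_of_real (B t \<omega> - g' t) * G (Y t) \<omega>" for t \<omega>
  have H_meas[measurable]: "(\<lambda>x. H (fst x) (snd x)) \<in> borel_measurable (L \<Otimes>\<^sub>M M)"
    and H'_meas[measurable]: "(\<lambda>x. H' (fst x) (snd x)) \<in> borel_measurable (L \<Otimes>\<^sub>M M)"
    using meas1 meas2 unfolding H_def H'_def L_def by (simp_all add: case_prod_beta')
  \<comment> \<open>The isometry integrates over time first; the fixed-time inequality needs the
    expectation inside, whence the exchange.\<close>
  have iso: "(\<integral>\<^sup>+t. (\<integral>\<^sup>+\<omega>. ennreal ((cmod (H t \<omega>))\<^sup>2) \<partial>M) \<partial>L) = ennreal ((l2n M I)\<^sup>2)"
  proof -
    have "(\<integral>\<^sup>+\<omega>. (\<integral>\<^sup>+t\<in>{0..T}. ennreal ((cmod (H t \<omega>))\<^sup>2) \<partial>lborel) \<partial>M) = ennreal ((l2n M I)\<^sup>2)"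
      unfolding H_def by (rule ito_isometry[OF BM I meas1 sq1])
    then show ?thesis
      unfolding L_int by (subst PP.Fubini'[symmetric]) auto
  qed
  have iso': "(\<integral>\<^sup>+t. (\<integral>\<^sup>+\<omega>. ennreal ((cmod (H' t \<omega>))\<^sup>2) \<partial>M) \<partial>L) = ennreal ((l2n M I')\<^sup>2)"
  proof -
    have "(\<integral>\<^sup>+\<omega>. (\<integral>\<^sup>+t\<in>{0..T}. ennreal ((cmod (H' t \<omega>))\<^sup>2) \<partial>lborel) \<partial>M) = ennreal ((l2n M I')\<^sup>2)"
      unfolding H'_def by (rule ito_isometry[OF BM I' meas2 sq2])
    then show ?thesis
      unfolding L_int by (subst PP.Fubini'[symmetric]) auto
  qed
  obtain N where N: "N \<in> null_sets M"
    and B_meas: "(\<lambda>x. if snd x \<in> N then 0 else B (fst x) (snd x)) \<in> borel_measurable (L \<Otimes>\<^sub>M M)"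
    using std_BM_jointly_measurable[OF BM T] unfolding L_def by blast
  have AE_N: "AE \<omega> in M. \<omega> \<notin> N" using N by (rule AE_not_in)
  have AE_L0: "AE t in L. t \<noteq> 0"
    unfolding L_def using AE_lborel_singleton[of 0] by (subst AE_restrict_space_iff) auto
  have AE_L: "AE t in L. 0 < t \<and> t \<le> T"
    using AE_L0 AE_space[of L] unfolding space_L by eventually_elim auto
  have fst_meas[measurable]: "fst \<in> borel_measurable (L \<Otimes>\<^sub>M M)"
    unfolding L_def by (rule measurable_compose[OF measurable_fst]) (auto intro: measurable_restrict_space1)
  note [measurable] = g
  define W where "W x = (if snd x \<in> N then 0 else B (fst x) (snd x)) - g (fst x)" for x
  have W_meas[measurable]: "W \<in> borel_measurable (L \<Otimes>\<^sub>M M)"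
    unfolding W_def[abs_def] by (intro borel_measurable_diff B_meas) measurable
  text \<open>\<open>Y\<close> itself need not be jointly measurable, but it agrees almost everywhere with \<open>Z\<close>.\<close>
  define Z where "Z x = H (fst x) (snd x) / complex_of_real (W x)" for x
  have Z_meas[measurable]: "Z \<in> borel_measurable (L \<Otimes>\<^sub>M M)"
    unfolding Z_def[abs_def] by measurable
  have Z_eq: "Z (t, \<omega>) = Y t \<omega>" if "\<omega> \<notin> N" "W (t, \<omega>) \<noteq> 0" for t \<omega>
    using that unfolding Z_def W_def H_def by (simp del: of_real_diff)
  have W_neq: "AE \<omega> in M. W (t, \<omega>) \<noteq> 0" if "0 < t" "t \<le> T" for t
    using std_BM_AE_neq[OF BM that, of "g t"] AE_N by eventually_elim (simp add: W_def)
  have "AE t in L. AE \<omega> in M. W (t, \<omega>) \<noteq> 0"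
    using AE_L by eventually_elim (use W_neq in blast)
  \<comment> \<open>Joint measurability of \<open>W\<close> allows the quantifiers to be exchanged:
    for almost every path, \<open>W\<close> is nonzero at almost every time.\<close>
  then have W_AE: "AE \<omega> in M. AE t in L. W (t, \<omega>) \<noteq> 0"
    by (subst (asm) PP.AE_commute) (simp_all, measurable)
  \<comment> \<open>\<open>Y\<close> enters only through a congruence up to null sets, which carries
    no measurability condition; the exchange of integrals is carried out on
    \<open>Z\<close>.\<close>
  have lhs: "(\<integral>\<^sup>+\<omega>. (\<integral>\<^sup>+t\<in>{0..T}. ennreal (t * (cmod (Y t \<omega>))\<^sup>2) \<partial>lborel) \<partial>M)
    = (\<integral>\<^sup>+t. (\<integral>\<^sup>+\<omega>. ennreal (t * (cmod (Z (t, \<omega>)))\<^sup>2) \<partial>M) \<partial>L)"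
  proof -
    have "(\<integral>\<^sup>+\<omega>. (\<integral>\<^sup>+t. ennreal (t * (cmod (Y t \<omega>))\<^sup>2) \<partial>L) \<partial>M)
      = (\<integral>\<^sup>+\<omega>. (\<integral>\<^sup>+t. ennreal (t * (cmod (Z (t, \<omega>)))\<^sup>2) \<partial>L) \<partial>M)"
    proof (rule nn_integral_cong_AE)
      show "AE \<omega> in M. (\<integral>\<^sup>+t. ennreal (t * (cmod (Y t \<omega>))\<^sup>2) \<partial>L) = (\<integral>\<^sup>+t. ennreal (t * (cmod (Z (t, \<omega>)))\<^sup>2) \<partial>L)"
        using W_AE AE_N
      proof eventually_elim
        case (elim \<omega>)
        from elim(1) show ?case
          by (intro nn_integral_cong_AE) (auto elim!: eventually_mono simp: Z_eq[OF elim(2)])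
      qed
    qed
    also have "\<dots> = (\<integral>\<^sup>+t. (\<integral>\<^sup>+\<omega>. ennreal (t * (cmod (Z (t, \<omega>)))\<^sup>2) \<partial>M) \<partial>L)"
    proof (rule PP.Fubini')
      have "(\<lambda>x. ennreal (fst x * (cmod (Z x))\<^sup>2)) \<in> borel_measurable (L \<Otimes>\<^sub>M M)" by measurable
      then show "(\<lambda>(t, \<omega>). ennreal (t * (cmod (Z (t, \<omega>)))\<^sup>2)) \<in> borel_measurable (L \<Otimes>\<^sub>M M)"
        by (simp add: case_prod_beta')
    qed
    finally show ?thesis unfolding L_int .
  qed
  \<comment> \<open>The product of norms is replaced by its weighted mean bound, which is linear in
    the squared norms and can be integrated over t with l fixed.\<close>
  have point: "2 * (\<integral>\<^sup>+\<omega>. ennreal (t * (cmod (Z (t, \<omega>)))\<^sup>2) \<partial>M)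
      \<le> ennreal l * (\<integral>\<^sup>+\<omega>. ennreal ((cmod (H t \<omega>))\<^sup>2) \<partial>M) + ennreal (1 / l) * (\<integral>\<^sup>+\<omega>. ennreal ((cmod (H' t \<omega>))\<^sup>2) \<partial>M)"
    if t: "0 < t" "t \<le> T" and l: "0 < l" for t l
  proof -
    have Yt: "Y t \<in> dom_D M B t" using Y_dom t by simp
    then have sqY: "sq_int M (Y t)" unfolding dom_D_def D_graph_def by auto
    note U = uncertainty_dom_D[OF BM t G_exp G_maps G_lin G_isom Yt]
    have H: "sq_int M (H t)" "sq_int M (H' t)" "t * (l2n M (Y t))\<^sup>2 \<le> l2n M (H t) * l2n M (H' t)"
      using U(1)[of "g t"] U(2)[of "g' t"] U(3)[of "g t" "g' t"] unfolding H_def[abs_def] H'_def[abs_def] by auto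
    have "(\<integral>\<^sup>+\<omega>. ennreal (t * (cmod (Z (t, \<omega>)))\<^sup>2) \<partial>M) = (\<integral>\<^sup>+\<omega>. ennreal t * ennreal ((cmod (Y t \<omega>))\<^sup>2) \<partial>M)"
      using W_neq[OF t] AE_N t
      by (intro nn_integral_cong_AE) (auto elim!: eventually_elim2 simp: Z_eq ennreal_mult)
    also have "\<dots> = ennreal t * ennreal ((l2n M (Y t))\<^sup>2)"
      using sq_int_measurable[OF sqY] by (subst nn_integral_cmult) (auto simp: sq_int_nn_integral[OF sqY])
    finally have "2 * (\<integral>\<^sup>+\<omega>. ennreal (t * (cmod (Z (t, \<omega>)))\<^sup>2) \<partial>M) = ennreal (2 * (t * (l2n M (Y t))\<^sup>2))"
      using t by (simp add: ennreal_mult)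
    also have "\<dots> \<le> ennreal (l * (l2n M (H t))\<^sup>2 + 1 / l * (l2n M (H' t))\<^sup>2)"
      using H(3) weighted_AMGM[OF l, of "l2n M (H t)" "l2n M (H' t)"] by (intro ennreal_leI) simp
    also have "\<dots> = ennreal l * ennreal ((l2n M (H t))\<^sup>2) + ennreal (1 / l) * ennreal ((l2n M (H' t))\<^sup>2)"
      using l by (simp add: ennreal_mult ennreal_plus del: times_divide_eq_left)
    finally show ?thesis
      unfolding sq_int_nn_integral[OF H(1)] sq_int_nn_integral[OF H(2)] .
  qed
  define A where "A = (\<integral>\<^sup>+t. (\<integral>\<^sup>+\<omega>. ennreal (t * (cmod (Z (t, \<omega>)))\<^sup>2) \<partial>M) \<partial>L)"
  have bound: "2 * A \<le> ennreal (l * (l2n M I)\<^sup>2 + (l2n M I')\<^sup>2 / l)" if l: "0 < l" for l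
  proof -
    have m: "(\<lambda>t. \<integral>\<^sup>+\<omega>. ennreal ((cmod (H t \<omega>))\<^sup>2) \<partial>M) \<in> borel_measurable L"
      "(\<lambda>t. \<integral>\<^sup>+\<omega>. ennreal ((cmod (H' t \<omega>))\<^sup>2) \<partial>M) \<in> borel_measurable L"
      by (intro borel_measurable_nn_integral; simp add: case_prod_beta'; measurable)+
    have mZ: "(\<lambda>t. \<integral>\<^sup>+\<omega>. ennreal (t * (cmod (Z (t, \<omega>)))\<^sup>2) \<partial>M) \<in> borel_measurable L"
      by (intro borel_measurable_nn_integral; simp add: case_prod_beta'; measurable)
    have "2 * A = (\<integral>\<^sup>+t. 2 * (\<integral>\<^sup>+\<omega>. ennreal (t * (cmod (Z (t, \<omega>)))\<^sup>2) \<partial>M) \<partial>L)"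
      unfolding A_def by (rule nn_integral_cmult[OF mZ, symmetric])
    also have "\<dots> \<le> (\<integral>\<^sup>+t. ennreal l * (\<integral>\<^sup>+\<omega>. ennreal ((cmod (H t \<omega>))\<^sup>2) \<partial>M)
        + ennreal (1 / l) * (\<integral>\<^sup>+\<omega>. ennreal ((cmod (H' t \<omega>))\<^sup>2) \<partial>M) \<partial>L)"
      by (rule nn_integral_mono_AE) (use AE_L in eventually_elim, use point l in blast)
    also have "\<dots> = ennreal l * ennreal ((l2n M I)\<^sup>2) + ennreal (1 / l) * ennreal ((l2n M I')\<^sup>2)"
      unfolding iso[symmetric] iso'[symmetric] using m by (simp add: nn_integral_add nn_integral_cmult)
    also have "\<dots> = ennreal (l * (l2n M I)\<^sup>2 + (l2n M I')\<^sup>2 / l)"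
      using l by (simp add: ennreal_mult[symmetric] ennreal_plus[symmetric] del: ennreal_plus)
    finally show ?thesis .
  qed
  \<comment> \<open>Finiteness of the left-hand side is part of the claim; the bound with l = 1
    gives it and lets \<open>A\<close> be treated as a real number.\<close>
  have "2 * A < \<infinity>" using bound[of 1] by (auto simp: less_top[symmetric] top_unique)
  then have "A < \<infinity>" by (auto simp: ennreal_mult_less_top)
  then obtain x where x: "0 \<le> x" "A = ennreal x" by (cases A) auto
  \<comment> \<open>Optimising over l only after the time integration is the Cauchy-Schwarz
    inequality in time.\<close>
  have "x \<le> l2n M I * l2n M I'"
  proof (rule le_mult_from_weighted_AMGM)
    fix l :: real assume l: "0 < l"
    have "ennreal (2 * x) \<le> ennreal (l * (l2n M I)\<^sup>2 + (l2n M I')\<^sup>2 / l)"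
      using bound[OF l] x by (simp add: ennreal_mult)
    then show "2 * x \<le> l * (l2n M I)\<^sup>2 + (l2n M I')\<^sup>2 / l"
      using l by (subst (asm) ennreal_le_iff) auto
  qed auto
  then show ?thesis
    unfolding lhs A_def[symmetric] x(2) l2n_def by (rule ennreal_leI)
qed

end
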